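(* There is a surjective continuous map $f\colon I\to I$, $I=[0,1]$, such that: (i) $f$ has exactly one infinite $\omega$-limit set $\tilde\omega$, and $f$ has zero topological entropy; (ii) $f$ is not Li–Yorke chaotic; (iii) the simple set $M(\tilde\omega)$ of the system associated with $\tilde\omega$ has non-empty interior; (iv) the non-degenerate connected components of $M(\tilde\omega)$ can be indexed as $\{G_n\}_{n\in\mathbb Z}$ so that $f(G_n)=G_{n+1}$ for every $n\in\mathbb Z$.
   Context: For $f\in C(I)$ and $x\in I$, the $\omega$-limit set of $x$ is the set of limit points of the sequence $(f^n(x))_{n\ge1}$. $f$ is Li–Yorke chaotic if there is an uncountable $S\subseteq I$ such that any distinct $x,y\in S$ satisfy $\limsup_n|f^n(x)-f^n(y)|>0$ and $\liminf_n|f^n(x)-f^n(y)|=0$. Associated system: if $h(f)=0$ and $\tilde\omega$ is an infinite $\omega$-limit set of $f$, there is a system $\mathcal I(\tilde\omega)=\{J(n,k):n\ge0,\ 0\le k<2^n\}$ of compact intervals such that for each $n$, $J(n,0),\dots,J(n,2^n-1)$ form an orbit of a minimal $f$-periodic interval of period $2^n$ (with $f(J(n,k))=J(n,k+1 \bmod 2^n)$), containing $\tilde\omega$ in their union, and $J(n+1,0)\subset J(n,0)$. The simple set is $M(\tilde\omega)=\bigcap_{n\ge0}\bigcup_{0\le k<2^n}J(n,k)$; it satisfies $f(M(\tilde\omega))=M(\tilde\omega)\supseteq\tilde\omega$. A component is non-degenerate if it is not a single point. *)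

theory Defs
  imports "HOL-Analysis.Analysis"
begin

abbreviation unitI :: "real set" where "unitI \<equiv> {0..1}"

definition omega_limit :: "(real \<Rightarrow> real) \<Rightarrow> real \<Rightarrow> real set" where
  "omega_limit f x = {y. \<forall>e>0. \<exists>\<^sub>F n in sequentially. dist ((f ^^ n) x) y < e}"

definition li_yorke_chaotic :: "(real \<Rightarrow> real) \<Rightarrow> bool" where
  "li_yorke_chaotic f \<longleftrightarrow> (\<exists>S. S \<subseteq> unitI \<and> uncountable S \<and>
     (\<forall>x\<in>S. \<forall>y\<in>S. x \<noteq> y \<longrightarrow>
        limsup (\<lambda>n. ereal \<bar>(f ^^ n) x - (f ^^ n) y\<bar>) > 0 \<and>
        liminf (\<lambda>n. ereal \<bar>(f ^^ n) x - (f ^^ n) y\<bar>) = 0))"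

text \<open>Topological entropy (Bowen, via (n,e)-separated sets) of f restricted to X.\<close>
definition separated :: "(real \<Rightarrow> real) \<Rightarrow> nat \<Rightarrow> real \<Rightarrow> real set \<Rightarrow> bool" where
  "separated f n e E \<longleftrightarrow> (\<forall>x\<in>E. \<forall>y\<in>E. x \<noteq> y \<longrightarrow> (\<exists>k<n. \<bar>(f ^^ k) x - (f ^^ k) y\<bar> > e))"

definition sep_num :: "(real \<Rightarrow> real) \<Rightarrow> real set \<Rightarrow> nat \<Rightarrow> real \<Rightarrow> nat" where
  "sep_num f X n e = Sup {card E | E. finite E \<and> E \<subseteq> X \<and> separated f n e E}"

definition top_entropy :: "(real \<Rightarrow> real) \<Rightarrow> real set \<Rightarrow> ereal" where
  "top_entropy f X = (SUP e\<in>{0<..}. limsup (\<lambda>n. ereal (ln (real (sep_num f X n e)) / real n)))"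

definition compact_interval :: "real set \<Rightarrow> bool" where
  "compact_interval J \<longleftrightarrow> (\<exists>a b. a \<le> b \<and> J = {a..b})"

definition periodic_interval :: "(real \<Rightarrow> real) \<Rightarrow> nat \<Rightarrow> real set \<Rightarrow> bool" where
  "periodic_interval f p K \<longleftrightarrow> compact_interval K \<and> K \<subseteq> unitI \<and> p \<ge> 1 \<and>
     (f ^^ p) ` K = K \<and>
     (\<forall>i<p. \<forall>j<p. i \<noteq> j \<longrightarrow> (f ^^ i) ` K \<inter> (f ^^ j) ` K = {})"

definition minimal_periodic_interval :: "(real \<Rightarrow> real) \<Rightarrow> nat \<Rightarrow> real set \<Rightarrow> real set \<Rightarrow> bool" where
  "minimal_periodic_interval f p W K \<longleftrightarrow> periodic_interval f p K \<and>
     W \<subseteq> (\<Union>i<p. (f ^^ i) ` K) \<and>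
     (\<forall>L. L \<subseteq> K \<and> periodic_interval f p L \<and> W \<subseteq> (\<Union>i<p. (f ^^ i) ` L) \<longrightarrow> L = K)"

definition assoc_system :: "(real \<Rightarrow> real) \<Rightarrow> real set \<Rightarrow> (nat \<Rightarrow> nat \<Rightarrow> real set) \<Rightarrow> bool" where
  "assoc_system f W J \<longleftrightarrow>
     (\<forall>n. minimal_periodic_interval f (2 ^ n) W (J n 0) \<and>
          (\<forall>k<2 ^ n. compact_interval (J n k) \<and> f ` (J n k) = J n ((k + 1) mod 2 ^ n)) \<and>
          W \<subseteq> (\<Union>k<2 ^ n. J n k) \<and>
          J (Suc n) 0 \<subseteq> J n 0)"

definition simple_set :: "(nat \<Rightarrow> nat \<Rightarrow> real set) \<Rightarrow> real set" where
  "simple_set J = (\<Inter>n. \<Union>k<2 ^ n. J n k)"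

definition nondeg_components :: "real set \<Rightarrow> real set set" where
  "nondeg_components M = {C. (\<exists>x\<in>M. C = connected_component_set M x) \<and> \<not> (\<exists>a. C = {a})}"

end

theory Submission
  imports Defs "HOL-Real_Asymp.Real_Asymp"
begin

text \<open>
  The map is built from two increasing embeddings of the unit interval into its left and right
  parts: \<open>embL\<close> is the identity on \<open>[0,1/5]\<close> and contracts \<open>[1/5,1]\<close> by the factor 4, and \<open>embR\<close>
  is its mirror image. The relations \<open>fmap \<circ> embL = embR\<close> and \<open>fmap \<circ> embR = embL \<circ> fmap\<close>, together
  with linearity on the gap \<open>[2/5,3/5]\<close> and \<open>fmap x = 1 - x\<close> on \<open>[4/5,1]\<close>, determine a continuous
  \<open>fmap\<close> that acts as the binary odometer on the nested images \<open>block n k\<close> of the unit interval under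
  words of length \<open>n\<close>.

  Each word of length \<open>n\<close> contracts \<open>[1/5,4/5]\<close> by \<open>4^n\<close>, and these images shrink to a Cantor set, the only
  infinite limit set. The rest of a block lies in the wandering intervals \<open>wander j\<close>, the
  components with integer address, which are permuted as \<open>wander j \<mapsto> wander (j + 1)\<close>. Each of them
  is visited at most once by an orbit and has a single point in the Cantor set, whence there
  are no Li-Yorke pairs.

  Entropy vanishes since both halves carry slowed-down copies of the dynamics and points
  in the expanding gap leave it after a time that is one of at most \<open>n\<close> choices; hence the orbit
  complexity satisfies \<open>B (2 n) \<le> C n (B (n + 1) + 1)\<close>, which is subexponential.
\<close>

section \<open>The map\<close>

definition embL :: "real \<Rightarrow> real" where
  "embL x = (if x \<le> 1/5 then x else x/4 + 3/20)"

definition embR :: "real \<Rightarrow> real" where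
  "embR x = (if x \<ge> 4/5 then x else x/4 + 3/5)"

text \<open>The first two branches are \<open>embR\<close> after the inverse of \<open>embL\<close>
  (the identity up to 1/5, then \<open>4 * x - 3/5\<close>). The recursive branch conjugates through
  the inverse \<open>4 * x - 12/5\<close> of \<open>embR\<close>. The slope -7/2 joins the value 1
  at 2/5 to the value \<open>embL (embR 0)\<close> = 3/10 at 3/5.\<close>

function fmap :: "real \<Rightarrow> real" where
  "fmap x =
    (if x \<le> 1/5 then embR x
     else if x \<le> 2/5 then embR (4 * x - 3/5)
     else if x < 3/5 then 1 - 7/2 * (x - 2/5)
     else if x < 4/5 then embL (fmap (4 * x - 12/5))
     else 1 - x)"
  by pat_completeness auto

text \<open>The recursive call multiplies the distance d to 4/5 by four. As d is at most 1/5, its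
  reciprocal drops by at least one, and so does the floor.\<close>

termination
proof (relation "Wellfounded.measure (\<lambda>x. nat \<lfloor>1 / (4/5 - x)\<rfloor>)")
  fix x :: real
  assume *: "\<not> x \<le> 1/5" "\<not> x \<le> 2/5" "\<not> x < 3/5" "x < 4/5"
  define d where "d = 4/5 - x"
  have d: "0 < d" "d \<le> 1/5" using * by (auto simp: d_def)
  have eq: "4/5 - (4 * x - 12/5) = 4 * d" by (simp add: d_def)
  have "1 / d \<ge> 5" using d by (simp add: field_simps)
  hence "1 / (4 * d) \<le> 1 / d - 1" by (simp add: field_simps)
  hence "\<lfloor>1 / (4 * d)\<rfloor> \<le> \<lfloor>1 / d\<rfloor> - 1" by linarith
  moreover have "\<lfloor>1 / d\<rfloor> \<ge> 5" using \<open>1 / d \<ge> 5\<close> by linarith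
  ultimately have "nat \<lfloor>1 / (4 * d)\<rfloor> < nat \<lfloor>1 / d\<rfloor>" by linarith
  thus "(4 * x - 12/5, x) \<in> Wellfounded.measure (\<lambda>x. nat \<lfloor>1 / (4/5 - x)\<rfloor>)"
    by (simp only: in_measure eq d_def[symmetric])
qed simp

declare fmap.simps [simp del]

lemma embL_strict_mono: "strict_mono embL"
  by (auto simp: strict_mono_def embL_def)

lemma embR_strict_mono: "strict_mono embR"
  by (auto simp: strict_mono_def embR_def)

lemma embL_diff_le: "\<bar>embL x - embL y\<bar> \<le> \<bar>x - y\<bar>"
  by (auto simp: embL_def)

lemma embR_diff_le: "\<bar>embR x - embR y\<bar> \<le> \<bar>x - y\<bar>"
  by (auto simp: embR_def)

lemma continuous_on_if_diff_le:
  fixes g :: "real \<Rightarrow> real"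
  assumes "\<And>x y. \<bar>g x - g y\<bar> \<le> \<bar>x - y\<bar>"
  shows "continuous_on S g"
  unfolding continuous_on_iff dist_real_def using assms by (meson order_le_less_trans)

lemma continuous_embL: "continuous_on S embL"
  by (rule continuous_on_if_diff_le) (rule embL_diff_le)

lemma continuous_embR: "continuous_on S embR"
  by (rule continuous_on_if_diff_le) (rule embR_diff_le)

lemma embL_image: "embL ` {0..1} = {0..2/5}"
proof
  show "{0..2/5} \<subseteq> embL ` {0..1}"
  proof
    fix y :: real assume "y \<in> {0..2/5}"
    hence "y = embL (if y \<le> 1/5 then y else 4 * y - 3/5)"
      "(if y \<le> 1/5 then y else 4 * y - 3/5) \<in> {0..1}" by (auto simp: embL_def field_simps)
    thus "y \<in> embL ` {0..1}" by blast
  qed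
qed (auto simp: embL_def)

lemma embR_image: "embR ` {0..1} = {3/5..1}"
proof
  show "{3/5..1} \<subseteq> embR ` {0..1}"
  proof
    fix y :: real assume "y \<in> {3/5..1}"
    hence "y = embR (if y \<ge> 4/5 then y else 4 * y - 12/5)"
      "(if y \<ge> 4/5 then y else 4 * y - 12/5) \<in> {0..1}" by (auto simp: embR_def field_simps)
    thus "y \<in> embR ` {0..1}" by blast
  qed
qed (auto simp: embR_def)

lemma fmap_embL: "x \<le> 1 \<Longrightarrow> fmap (embL x) = embR x"
  by (subst fmap.simps) (auto simp: embL_def)

text \<open>From 4/5 on, \<open>embR\<close> is the identity and \<open>1 - x\<close> is at most
  1/5, where \<open>embL\<close> is the identity; so the last branch obeys the same relation as the
  recursive one.\<close>

lemma fmap_embR: 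
  assumes "0 \<le> x" shows "fmap (embR x) = embL (fmap x)"
proof (cases "x \<ge> 4/5")
  case True
  thus ?thesis by (simp add: embR_def fmap.simps[of x] embL_def)
next
  case False
  hence "fmap (embR x) = embL (fmap (4 * (x/4 + 3/5) - 12/5))"
    using assms by (subst fmap.simps) (auto simp: embR_def)
  thus ?thesis by simp
qed

lemma fmap_gap: "2/5 \<le> x \<Longrightarrow> x < 3/5 \<Longrightarrow> fmap x = 1 - 7/2 * (x - 2/5)"
  by (auto simp: fmap.simps[of x] embR_def field_simps)

lemma fmap_right: "4/5 \<le> x \<Longrightarrow> fmap x = 1 - x"
  by (simp add: fmap.simps[of x])

lemma fmap_left_bounds:
  assumes "0 \<le> x" "x < 3/5" shows "3/10 \<le> fmap x" "fmap x \<le> 1"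
  using assms by (auto simp: fmap.simps[of x] embR_def field_simps)

text \<open>The recursion cuts the excess over 1/5 by four while its argument is four times as far
  from 4/5, so the linear bound reproduces itself; the factor 4 covers the base range, where the
  excess is at most 4/5. The bound serves for continuity at 4/5, near which the recursion depth is
  unbounded.\<close>

lemma fmap_near_right:
  assumes "0 \<le> x" "x < 4/5"
  shows "1/5 \<le> fmap x \<and> fmap x \<le> 1 \<and> fmap x - 1/5 \<le> 4 * (4/5 - x)"
  using assms
proof (induction x rule: fmap.induct)
  case (1 x)
  show ?case
  proof (cases "x < 3/5")
    case True
    thus ?thesis using fmap_left_bounds[of x] 1 by auto
  next
    case False
    have eq: "fmap x = embL (fmap (4 * x - 12/5))"
      using False 1 by (simp add: fmap.simps[of x])
    have "1/5 \<le> fmap (4 * x - 12/5) \<and> fmap (4 * x - 12/5) \<le> 1 \<and>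
      fmap (4 * x - 12/5) - 1/5 \<le> 4 * (4/5 - (4 * x - 12/5))"
      using False 1 by auto
    thus ?thesis unfolding eq embL_def using 1 by auto
  qed
qed

lemma fmap_in_unit: "x \<in> {0..1} \<Longrightarrow> fmap x \<in> {0..1}"
  using fmap_near_right[of x] fmap_right[of x] by (cases "x < 4/5") auto

lemma fmap_funpow_in_unit: "x \<in> {0..1} \<Longrightarrow> (fmap ^^ t) x \<in> {0..1}"
  by (induction t) (use fmap_in_unit in auto)

section \<open>Continuity of the map\<close>

lemma continuous_fmap_left: "continuous_on {0..3/5} fmap"
proof -
  have 1: "continuous_on {0..2/5} fmap"
  proof (rule continuous_on_eq)
    show "continuous_on {0..2/5} (\<lambda>x. embR (max x (4 * x - 3/5)))"
      by (intro continuous_on_compose2[OF continuous_embR[of UNIV]] continuous_intros) auto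
    show "embR (max x (4 * x - 3/5)) = fmap x" if "x \<in> {0..2/5}" for x
    proof (cases "x \<le> 1/5")
      case True
      hence "max x (4 * x - 3/5) = x" by simp
      thus ?thesis using True by (simp add: fmap.simps[of x])
    next
      case False
      hence "max x (4 * x - 3/5) = 4 * x - 3/5" by simp
      thus ?thesis using False that by (simp add: fmap.simps[of x])
    qed
  qed
  have end_val: "fmap (3/5) = 3/10"
    by (simp add: fmap.simps[of "3/5"] fmap.simps[of 0] embR_def embL_def)
  have 2: "continuous_on {2/5..3/5} fmap"
  proof (rule continuous_on_eq)
    show "continuous_on {2/5..3/5} (\<lambda>x::real. 1 - 7/2 * (x - 2/5))"
      by (intro continuous_intros)
    show "1 - 7/2 * (x - 2/5) = fmap x" if "x \<in> {2/5..3/5}" for x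
    proof (cases "x < 3/5")
      case True
      thus ?thesis using that fmap_gap[of x] by simp
    next
      case False
      hence "x = 3/5" using that by simp
      thus ?thesis using end_val by (simp only:) simp
    qed
  qed
  have "{0..3/5} = {0..2/5} \<union> {2/5..3/5::real}" by auto
  thus ?thesis using continuous_on_closed_Un[OF _ _ 1 2] by simp
qed

text \<open>The right ends r_k satisfy 4 r_(k+1) - 12/5 = r_k, so each level of the recursion
  carries continuity one interval further, starting from r_0 = 3/5.\<close>

lemma continuous_fmap_before: "continuous_on {0..4/5 - (1/4)^k/5} fmap"
proof (induction k)
  case 0
  thus ?case using continuous_fmap_left by simp
next
  case (Suc k)
  let ?r = "4/5 - (1/4)^Suc k/5 :: real"
  have r: "3/5 \<le> ?r" "?r < 4/5" using power_le_one[of "1/4::real" "Suc k"] by auto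
  have "continuous_on {3/5..?r} fmap"
  proof (rule continuous_on_eq)
    show "continuous_on {3/5..?r} (\<lambda>x. embL (fmap (4 * x - 12/5)))"
      by (intro continuous_on_compose2[OF continuous_embL[of UNIV]]
          continuous_on_compose2[OF Suc] continuous_intros) auto
    show "embL (fmap (4 * x - 12/5)) = fmap x" if "x \<in> {3/5..?r}" for x
    proof -
      have "\<not> x \<le> 2/5" "\<not> x < 3/5" "x < 4/5"
        using that r unfolding atLeastAtMost_iff by linarith+
      thus ?thesis by (simp add: fmap.simps[of x])
    qed
  qed
  moreover have "{0..?r} = {0..3/5} \<union> {3/5..?r}" using r by auto
  ultimately show ?case
    using continuous_on_closed_Un[OF _ _ continuous_fmap_left] by simp
qed

text \<open>Left of 4/5 finitely many levels of the recursion suffice locally; at 4/5 itself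
  \<open>fmap_near_right\<close> gives a Lipschitz bound.\<close>

lemma continuous_fmap: "continuous_on {0..1} fmap"
proof -
  have "continuous_on {0..4/5} fmap"
    unfolding continuous_on_eq_continuous_within
  proof
    fix x :: real assume x: "x \<in> {0..4/5}"
    show "continuous (at x within {0..4/5}) fmap"
    proof (cases "x = 4/5")
      case True
      have bd: "\<bar>fmap y - 1/5\<bar> \<le> 4 * \<bar>y - 4/5\<bar>" if "y \<in> {0..4/5}" for y
        using that fmap_near_right[of y] fmap_right[of y] by (cases "y < 4/5") auto
      show ?thesis
        unfolding continuous_within_eps_delta dist_real_def True
      proof (intro allI impI)
        fix e :: real assume "e > 0"
        have "\<bar>fmap y - fmap (4/5)\<bar> < e" if "y \<in> {0..4/5}" "\<bar>y - 4/5\<bar> < e/4" for y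
          using bd[OF that(1)] that(2) by (simp add: fmap_right)
        thus "\<exists>d>0. \<forall>y\<in>{0..4/5}. \<bar>y - 4/5\<bar> < d \<longrightarrow> \<bar>fmap y - fmap (4/5)\<bar> < e"
          using \<open>e > 0\<close> by (intro exI[of _ "e/4"]) auto
      qed
    next
      case False
      hence "4/5 - x > 0" using x by auto
      then obtain k where k: "(1/4::real)^k < 5 * (4/5 - x)"
        using real_arch_pow_inv[of "5 * (4/5 - x)" "1/4"] by auto
      let ?r = "4/5 - (1/4)^k/5 :: real"
      have xr: "x < ?r" using k by simp
      have "continuous (at x within {0..?r}) fmap"
        using continuous_fmap_before[of k] x xr by (simp add: continuous_on_eq_continuous_within)
      moreover have "at x within {0..?r} = at x within {0..4/5}"
      proof (rule at_within_nhd[of x "{..<?r}"])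
        have "?r \<le> 4/5" by simp
        hence "z \<in> {0..?r} \<inter> {..<?r} \<longleftrightarrow> z \<in> {0..4/5} \<inter> {..<?r}" for z
          unfolding Int_iff atLeastAtMost_iff lessThan_iff by linarith
        thus "{0..?r} \<inter> {..<?r} - {x} = {0..4/5} \<inter> {..<?r} - {x}" by blast
      qed (use xr in auto)
      ultimately show ?thesis by simp
    qed
  qed
  moreover have "continuous_on {4/5..1} fmap"
    by (rule continuous_on_eq[of _ "\<lambda>x. 1 - x"]) (auto intro!: continuous_intros simp: fmap_right)
  moreover have "{0..1} = {0..4/5} \<union> {4/5..1::real}" by auto
  ultimately show ?thesis by (metis continuous_on_closed_Un closed_atLeastAtMost)
qed

lemma fmap_two_fifths: "fmap (2/5) = 1" by (simp add: fmap_gap)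
lemma fmap_one: "fmap 1 = 0" by (simp add: fmap_right)

lemma fmap_image: "fmap ` {0..1} = {0..1}"
proof
  show "fmap ` {0..1} \<subseteq> {0..1}" using fmap_in_unit by blast
  have "connected (fmap ` {0..1})"
    by (intro connected_continuous_image continuous_fmap) simp
  moreover have "0 \<in> fmap ` {0..1}" "1 \<in> fmap ` {0..1}"
    using fmap_one fmap_two_fifths by (auto intro!: rev_image_eqI[of 1] rev_image_eqI[of "2/5"])
  ultimately show "{0..1} \<subseteq> fmap ` {0..1}" by (rule connected_contains_Icc)
qed

section \<open>Blocks, cores and wandering intervals\<close>

text \<open>The binary digits of \<open>k\<close> are read from the least significant one, which is
  the outermost letter. Integer addresses admit negative \<open>k\<close>, whose expansions end in
  ones.\<close>

primrec emb :: "nat \<Rightarrow> int \<Rightarrow> real \<Rightarrow> real" where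
  "emb 0 k = id"
| "emb (Suc n) k = (if even k then embL else embR) \<circ> emb n (k div 2)"

definition block :: "nat \<Rightarrow> int \<Rightarrow> real set" where
  "block n k = emb n k ` {0..1}"

text \<open>Both letters map [1/5,4/5] into itself and contract it by exactly 4, so this is the part
  of a block that shrinks.\<close>

definition core :: "nat \<Rightarrow> int \<Rightarrow> real set" where
  "core n k = emb n k ` {1/5..4/5}"

text \<open>The integers are the 2-adic addresses whose digits are eventually constant, and they
  form the full odometer orbit of 0.\<close>

definition wander :: "int \<Rightarrow> real set" where
  "wander j = (\<Inter>n. block n j)"

lemma emb_strict_mono: "strict_mono (emb n k)"
proof (induction n arbitrary: k)
  case 0 thus ?case by (simp add: strict_mono_def)
next
  case (Suc n)
  show ?case using Suc[of "k div 2"] embL_strict_mono embR_strict_mono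
    by (auto simp: strict_mono_def)
qed

lemma emb_less_iff [simp]: "emb n k x < emb n k y \<longleftrightarrow> x < y"
  by (rule strict_mono_less[OF emb_strict_mono])

lemma emb_le_iff [simp]: "emb n k x \<le> emb n k y \<longleftrightarrow> x \<le> y"
  by (rule strict_mono_less_eq[OF emb_strict_mono])

lemma emb_eq_iff [simp]: "emb n k x = emb n k y \<longleftrightarrow> x = y"
  by (rule strict_mono_eq[OF emb_strict_mono])

lemma emb_diff_le: "\<bar>emb n k x - emb n k y\<bar> \<le> \<bar>x - y\<bar>"
proof (induction n arbitrary: k)
  case (Suc n)
  show ?case using Suc[of "k div 2"] order_trans[OF embL_diff_le] order_trans[OF embR_diff_le]
    by simp
qed simp

lemma continuous_emb: "continuous_on S (emb n k)"
  by (rule continuous_on_if_diff_le) (rule emb_diff_le)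

lemma emb_image_Icc:
  assumes "a \<le> b" shows "emb n k ` {a..b} = {emb n k a..emb n k b}"
proof
  show "{emb n k a..emb n k b} \<subseteq> emb n k ` {a..b}"
    by (rule connected_contains_Icc)
      (use assms in \<open>auto intro!: connected_continuous_image continuous_emb\<close>)
qed auto

lemma emb_in_unit: "x \<in> {0..1} \<Longrightarrow> emb n k x \<in> {0..1}"
proof (induction n arbitrary: k)
  case (Suc n)
  hence u: "emb n (k div 2) x \<in> {0..1}" by blast
  have "embL (emb n (k div 2) x) \<in> {0..2/5}" "embR (emb n (k div 2) x) \<in> {3/5..1}"
    using u embL_image embR_image by blast+
  thus ?case by auto
qed auto

section \<open>Addresses modulo powers of two and the odometer action\<close>

lemma emb_add_power: "emb n (k + 2 ^ n * l) = emb n k"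
proof (induction n arbitrary: k)
  case (Suc n)
  have "(k + 2 ^ Suc n * l) div 2 = k div 2 + 2 ^ n * l" by (simp add: mult.assoc)
  thus ?case using Suc[of "k div 2"] by simp
qed simp

lemma emb_cong: "k mod 2 ^ n = l mod 2 ^ n \<Longrightarrow> emb n k = emb n l"
  by (metis emb_add_power mod_mult_div_eq)

text \<open>This is addition of one with carry: an even outer digit becomes odd and the process
  stops, an odd one becomes even and passes the carry inwards. The carry crosses all
  \<open>n\<close> digits exactly when \<open>2 ^ n\<close> divides \<open>k + 1\<close>, and only
  then does \<open>fmap\<close> act on the inner point.\<close>

lemma fmap_emb:
  assumes "x \<in> {0..1}"
  shows "fmap (emb n k x) = emb n (k + 1) (if 2 ^ n dvd k + 1 then fmap x else x)"
proof (induction n arbitrary: k)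
  case (Suc n)
  have u: "emb n (k div 2) x \<in> {0..1}" using assms by (rule emb_in_unit)
  show ?case
  proof (cases "even k")
    case True
    hence "\<not> 2 ^ Suc n dvd k + 1" by (metis dvd_mult_left even_plus_one_iff power_Suc)
    moreover have "(k + 1) div 2 = k div 2" using True by simp
    ultimately show ?thesis using True u by (simp add: fmap_embL)
  next
    case False
    then obtain i where i: "k = 2 * i + 1" by (elim oddE)
    have "2 ^ Suc n dvd k + 1 \<longleftrightarrow> 2 ^ n dvd i + 1"
    proof -
      have "k + 1 = 2 * (i + 1)" using i by simp
      thus ?thesis by (simp only: power_Suc dvd_mult_cancel_left) simp
    qed
    moreover have "(k + 1) div 2 = i + 1" "k div 2 = i" using i by auto
    ultimately show ?thesis using False u Suc[of i] by (simp add: fmap_embR)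
  qed
qed simp

lemma block_eq_Icc: "block n k = {emb n k 0..emb n k 1}"
  by (simp add: block_def emb_image_Icc)

lemma core_eq_Icc: "core n k = {emb n k (1/5)..emb n k (4/5)}"
  by (simp add: core_def emb_image_Icc)

lemma block_0 [simp]: "block 0 k = {0..1}"
  by (simp add: block_def)

lemma block_Suc: "block (Suc n) k = (if even k then embL else embR) ` block n (k div 2)"
  by (simp add: block_def image_comp)

lemma core_Suc: "core (Suc n) k = (if even k then embL else embR) ` core n (k div 2)"
  by (simp add: core_def image_comp)

lemma block_cong: "k mod 2 ^ n = l mod 2 ^ n \<Longrightarrow> block n k = block n l"
  unfolding block_def using emb_cong by metis

lemma core_cong: "k mod 2 ^ n = l mod 2 ^ n \<Longrightarrow> core n k = core n l"
  unfolding core_def using emb_cong by metis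

lemma block_mod: "block n (k mod 2 ^ n) = block n k"
  by (rule block_cong) simp

lemma core_mod: "core n (k mod 2 ^ n) = core n k"
  by (rule core_cong) simp

lemma core_subset_block: "core n k \<subseteq> block n k"
  by (auto simp: core_def block_def)

lemma block_subset_unit: "block n k \<subseteq> {0..1}"
  unfolding block_def using emb_in_unit by blast

text \<open>Refinement appends a letter on the inside while the recursion of \<open>emb\<close>
  prepends one on the outside, so the induction peels the outer letter.\<close>

lemma block_Suc_subset: "block (Suc n) k \<subseteq> block n k"
proof (induction n arbitrary: k)
  case 0 thus ?case using block_subset_unit by simp
next
  case (Suc n)
  show ?case
    unfolding block_Suc[of "Suc n" k] block_Suc[of n k] using Suc[of "k div 2"] by (rule image_mono)
qed

lemma block_antimono: "m \<le> n \<Longrightarrow> block n k \<subseteq> block m k"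
  by (induction rule: dec_induct) (use block_Suc_subset in blast)+

lemma core_Suc_subset: "core (Suc n) k \<subseteq> core n k"
proof (induction n arbitrary: k)
  case 0 thus ?case by (auto simp: core_def embL_def embR_def)
next
  case (Suc n)
  show ?case
    unfolding core_Suc[of "Suc n" k] core_Suc[of n k] using Suc[of "k div 2"] by (rule image_mono)
qed

lemma core_subset_middle: "core n k \<subseteq> {1/5..4/5}"
proof (induction n arbitrary: k)
  case (Suc n) thus ?case using core_Suc_subset by blast
qed (simp add: core_def)

lemma core_diameter:
  assumes "x \<in> core n k" "y \<in> core n k"
  shows "\<bar>x - y\<bar> \<le> (1/4) ^ n"
  using assms
proof (induction n arbitrary: k x y)
  case 0 thus ?case by (auto simp: core_def)
next
  case (Suc n)
  let ?e = "if even k then embL else embR"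
  obtain u v where uv: "x = ?e u" "y = ?e v" "u \<in> core n (k div 2)" "v \<in> core n (k div 2)"
    using Suc.prems unfolding core_Suc by blast
  have "u \<in> {1/5..4/5}" "v \<in> {1/5..4/5}" using uv core_subset_middle by blast+
  hence "?e u - ?e v = (u - v) / 4" by (auto simp: embL_def embR_def field_simps)
  hence "\<bar>?e u - ?e v\<bar> = \<bar>u - v\<bar> / 4" by (simp only: abs_divide abs_numeral)
  thus ?case unfolding uv(1,2) using Suc.IH[OF uv(3,4)] by simp
qed

text \<open>When the carry runs through the whole word, equality rests on the surjectivity of
  \<open>fmap\<close>; otherwise the inner point is unchanged.\<close>

lemma fmap_block: "fmap ` block n k = block n (k + 1)"
proof -
  have "fmap ` block n k = emb n (k + 1) ` (\<lambda>x. if 2 ^ n dvd k + 1 then fmap x else x) ` {0..1}"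
    unfolding block_def image_image using fmap_emb by (intro image_cong) auto
  also have "(\<lambda>x. if 2 ^ n dvd k + 1 then fmap x else x) ` {0..1} = {0..1}"
    using fmap_image by simp
  finally show ?thesis by (simp add: block_def)
qed

lemma funpow_block: "(fmap ^^ t) ` block n k = block n (k + int t)"
proof (induction t)
  case (Suc t)
  have "(fmap ^^ Suc t) ` block n k = fmap ` (fmap ^^ t) ` block n k" by (simp add: image_comp)
  thus ?case using Suc by (simp add: fmap_block ac_simps)
qed simp

lemma funpow_in_block: "x \<in> block n k \<Longrightarrow> (fmap ^^ t) x \<in> block n (k + int t)"
  using funpow_block by blast

text \<open>The ranges of \<open>embL\<close> and \<open>embR\<close> lie on either side of the gap,
  so different lowest digits separate; equal ones are peeled off by injectivity.\<close>

lemma block_disjoint: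
  assumes "k mod 2 ^ n \<noteq> l mod 2 ^ n" shows "block n k \<inter> block n l = {}"
  using assms
proof (induction n arbitrary: k l)
  case (Suc n)
  have disj: "embL ` block n i \<inter> embR ` block n j = {}" for i j
  proof -
    have "embL ` block n i \<subseteq> {0..2/5}" "embR ` block n j \<subseteq> {3/5..1}"
      using block_subset_unit embL_image embR_image by blast+
    thus ?thesis by fastforce
  qed
  show ?case
  proof (cases "even k = even l")
    case True
    have "k div 2 mod 2 ^ n \<noteq> l div 2 mod 2 ^ n"
    proof
      assume "k div 2 mod 2 ^ n = l div 2 mod 2 ^ n"
      moreover have "j mod 2 ^ Suc n = 2 * (j div 2 mod 2 ^ n) + j mod 2" for j :: int
        using zmod_zmult2_eq[of "2 ^ n" j 2] by (simp add: mult.commute)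
      moreover have "k mod 2 = l mod 2" using True by presburger
      ultimately show False using Suc.prems by simp
    qed
    hence "block n (k div 2) \<inter> block n (l div 2) = {}" by (rule Suc.IH)
    moreover have "inj embL" "inj embR"
      using embL_strict_mono embR_strict_mono strict_mono_imp_inj_on by blast+
    ultimately show ?thesis using True
      by (cases "even k") (simp_all add: block_Suc flip: image_Int)
  next
    case False
    thus ?thesis unfolding block_Suc using disj by auto
  qed
qed simp

lemma block_eq_mod: "x \<in> block n k \<Longrightarrow> x \<in> block n l \<Longrightarrow> k mod 2 ^ n = l mod 2 ^ n"
  using block_disjoint by blast

section \<open>Wandering intervals\<close>

lemma fifth_in_wander: "{0..1/5} \<subseteq> wander 0"
proof -
  have "emb n 0 x = x" if "x \<in> {0..1/5}" for n x
    using that by (induction n) (auto simp: embL_def)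
  hence "x \<in> emb n 0 ` {0..1}" if "x \<in> {0..1/5}" for n x
    using that by (intro image_eqI[of _ _ x]) auto
  thus ?thesis unfolding wander_def block_def by blast
qed

lemma last_fifth_in_wander: "{4/5..1} \<subseteq> wander (-1)"
proof -
  have "emb n (-1) x = x" if "x \<in> {4/5..1}" for n x
    using that by (induction n) (auto simp: embR_def)
  hence "x \<in> emb n (-1) ` {0..1}" if "x \<in> {4/5..1}" for n x
    using that by (intro image_eqI[of _ _ x]) auto
  thus ?thesis unfolding wander_def block_def by blast
qed

lemma emb1_wander: "x \<in> wander (k div 2) \<Longrightarrow> (if even k then embL else embR) x \<in> wander k"
proof -
  assume x: "x \<in> wander (k div 2)"
  have "(if even k then embL else embR) x \<in> block n k" for n
  proof -
    have "(if even k then embL else embR) x \<in> block (Suc n) k"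
      unfolding block_Suc using x by (auto simp: wander_def)
    thus ?thesis using block_Suc_subset by blast
  qed
  thus ?thesis by (auto simp: wander_def)
qed

text \<open>All digits of \<open>k\<close> beyond the first \<open>n\<close> are 0, and the
  corresponding letter \<open>embL\<close> fixes [0,1/5] pointwise, so longer words act there in the
  same way.\<close>

lemma emb_left_wander:
  "0 \<le> k \<Longrightarrow> k < 2 ^ n \<Longrightarrow> x \<in> {0..1/5} \<Longrightarrow> emb n k x \<in> wander k"
proof (induction n arbitrary: k)
  case 0
  hence "k = 0" by simp
  thus ?case using 0 fifth_in_wander by auto
next
  case (Suc n)
  hence "emb n (k div 2) x \<in> wander (k div 2)" by auto
  from emb1_wander[OF this] show ?case by simp
qed

text \<open>\<open>k - 2 ^ n\<close> shares its first \<open>n\<close> digits with \<open>k\<close>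
  and continues with ones only, which matches the letter \<open>embR\<close> fixing [4/5,1]
  pointwise.\<close>

lemma emb_right_wander:
  "0 \<le> k \<Longrightarrow> k < 2 ^ n \<Longrightarrow> x \<in> {4/5..1} \<Longrightarrow> emb n k x \<in> wander (k - 2 ^ n)"
proof (induction n arbitrary: k)
  case 0
  hence "k - 2 ^ 0 = -1" by simp
  thus ?case using 0 last_fifth_in_wander by auto
next
  case (Suc n)
  have "(k - 2 ^ Suc n) div 2 = k div 2 - 2 ^ n" by simp
  moreover have "even (k - 2 ^ Suc n) = even k" by simp
  moreover have "emb n (k div 2) x \<in> wander (k div 2 - 2 ^ n)" using Suc by auto
  ultimately show ?case using emb1_wander[of "emb n (k div 2) x" "k - 2 ^ Suc n"] by simp
qed

text \<open>The cases come from the two outer fifths and the middle of the unit interval. The bounds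
  on \<open>j\<close> matter later: only finitely many wandering intervals are needed to cover a
  level outside its cores.\<close>

lemma block_cases:
  assumes "x \<in> block n k"
  obtains "x \<in> core n k" | j where "- (2 ^ n) \<le> j" "j < 2 ^ n" "x \<in> wander j"
proof -
  let ?k = "k mod 2 ^ n"
  obtain u where u: "u \<in> {0..1}" "x = emb n ?k u"
    using assms block_mod[of n k] unfolding block_def by blast
  have pos: "(0::int) < 2 ^ n" by simp
  have k: "0 \<le> ?k" "?k < 2 ^ n" by auto
  consider "u \<in> {0..1/5}" | "u \<in> {1/5..4/5}" | "u \<in> {4/5..1}"
    using u(1) unfolding atLeastAtMost_iff by linarith
  thus ?thesis
  proof cases
    case 1
    have "- (2 ^ n) \<le> ?k" using k pos by linarith
    thus ?thesis using that(2)[of ?k] emb_left_wander[OF k 1] u k by blast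
  next
    case 2
    hence "x \<in> core n ?k" using u unfolding core_def by blast
    thus ?thesis using that(1) core_mod by simp
  next
    case 3
    have "- (2 ^ n) \<le> ?k - 2 ^ n" "?k - 2 ^ n < 2 ^ n" using k pos by linarith+
    thus ?thesis using that(2)[of "?k - 2 ^ n"] emb_right_wander[OF k 3] u by blast
  qed
qed

lemma ex_abs_less_power2: "\<exists>n. \<bar>j :: int\<bar> < 2 ^ n"
proof
  have "int (nat \<bar>j\<bar>) < int (2 ^ nat \<bar>j\<bar>)"
    unfolding of_nat_less_iff by (rule less_exp)
  thus "\<bar>j\<bar> < 2 ^ nat \<bar>j\<bar>" by simp
qed

text \<open>Distinct integers have different residues modulo a large power of two, which puts the
  two intervals in disjoint blocks.\<close>

lemma wander_disjoint:
  assumes "i \<noteq> j" shows "wander i \<inter> wander j = {}"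
proof (rule ccontr)
  assume "wander i \<inter> wander j \<noteq> {}"
  then obtain x where "\<And>n. x \<in> block n i" "\<And>n. x \<in> block n j"
    by (auto simp: wander_def)
  hence eq: "i mod 2 ^ n = j mod 2 ^ n" for n using block_eq_mod by blast
  obtain n where "\<bar>i - j\<bar> < 2 ^ n" using ex_abs_less_power2 by blast
  moreover have "2 ^ n dvd i - j" using eq[of n] by (simp add: mod_eq_dvd_iff)
  ultimately show False using assms dvd_imp_le_int[of "i - j" "2 ^ n"] by auto
qed

lemma funpow_wander: "x \<in> wander j \<Longrightarrow> (fmap ^^ t) x \<in> wander (j + int t)"
  unfolding wander_def using funpow_in_block by blast

lemma wander_Icc: "\<exists>a b. wander j = {a..b}"
proof -
  have "convex (block n j)" "compact (block n j)" for n by (simp_all add: block_eq_Icc)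
  hence "convex (wander j)" "compact (wander j)"
    unfolding wander_def by (intro convex_INT compact_Inter; auto)+
  thus ?thesis using connected_compact_interval_1 convex_connected by blast
qed

lemma wander_nondegenerate: "\<exists>x\<in>wander j. \<exists>y\<in>wander j. x \<noteq> y"
proof -
  obtain n where n: "\<bar>j\<bar> < 2 ^ n" using ex_abs_less_power2 by blast
  show ?thesis
  proof (cases "j \<ge> 0")
    case True
    hence "emb n j 0 \<in> wander j" "emb n j (1/5) \<in> wander j"
      using n emb_left_wander[of j n] by auto
    thus ?thesis by (metis emb_eq_iff zero_neq_one divide_eq_0_iff zero_neq_numeral)
  next
    case False
    hence "emb n (j + 2 ^ n) 1 \<in> wander j" "emb n (j + 2 ^ n) (4/5) \<in> wander j"
      using n emb_right_wander[of "j + 2 ^ n" n] by auto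
    moreover have "emb n (j + 2 ^ n) 1 \<noteq> emb n (j + 2 ^ n) (4/5)" by simp
    ultimately show ?thesis by blast
  qed
qed

text \<open>Surjectivity between blocks passes to the intersection by compactness: the preimages of
  \<open>y\<close> in the nested blocks are nonempty compact sets and have a common point.\<close>

lemma fmap_wander: "fmap ` wander j = wander (j + 1)"
proof
  show "fmap ` wander j \<subseteq> wander (j + 1)" unfolding wander_def using fmap_block by blast
  show "wander (j + 1) \<subseteq> fmap ` wander j"
  proof
    fix y assume y: "y \<in> wander (j + 1)"
    let ?P = "\<lambda>n. {x \<in> block n j. fmap x = y}"
    have cont: "continuous_on (block n j) fmap" for n
      using continuous_on_subset[OF continuous_fmap block_subset_unit] .
    have "(\<Inter>n. ?P n) \<noteq> {}"
    proof (rule compact_nest)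
      show "compact (?P n)" for n
      proof -
        have "closed (?P n)"
          using continuous_closed_preimage_constant[OF cont] by (simp add: block_eq_Icc)
        moreover have "?P n = block n j \<inter> ?P n" by blast
        ultimately show ?thesis
          using compact_Int_closed[of "block n j" "?P n"] by (simp add: block_eq_Icc)
      qed
      show "?P n \<noteq> {}" for n
      proof -
        have "y \<in> fmap ` block n j" using y unfolding fmap_block by (auto simp: wander_def)
        thus ?thesis by blast
      qed
      show "?P n \<subseteq> ?P m" if "m \<le> n" for m n using block_antimono[OF that] by blast
    qed
    thus "y \<in> fmap ` wander j" unfolding wander_def by blast
  qed
qed

section \<open>Limit sets\<close>

definition blocks :: "nat \<Rightarrow> real set" where
  "blocks n = (\<Union>k. block n k)"

definition cores :: "nat \<Rightarrow> real set" where
  "cores n = (\<Union>k. core n k)"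

definition cantor :: "real set" where
  "cantor = (\<Inter>n. cores n)"

text \<open>Each \<open>blocks n\<close> is forward invariant, so entering it once means staying.
  This property divides the orbits into those attracted by the Cantor set and those that end on a
  periodic orbit.\<close>

definition deep :: "real \<Rightarrow> bool" where
  "deep x \<longleftrightarrow> (\<forall>n. \<exists>t. (fmap ^^ t) x \<in> blocks n)"

lemma funpow_split: "s \<le> t \<Longrightarrow> (f ^^ t) x = (f ^^ (t - s)) ((f ^^ s) x)"
  by (metis funpow_add comp_apply le_add_diff_inverse2)

lemma blocks_eq_finite_UN: "blocks n = (\<Union>k\<in>{0..<2 ^ n}. block n k)"
proof -
  have "block n k \<subseteq> (\<Union>k\<in>{0..<2 ^ n}. block n k)" for k
    using block_mod[of n k]
      by (metis UN_upper atLeastLessThan_iff pos_mod_bound pos_mod_sign zero_less_numeral zero_less_power)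
  thus ?thesis unfolding blocks_def by blast
qed

lemma cores_eq_finite_UN: "cores n = (\<Union>k\<in>{0..<2 ^ n}. core n k)"
proof -
  have "core n k \<subseteq> (\<Union>k\<in>{0..<2 ^ n}. core n k)" for k
    using core_mod[of n k]
      by (metis UN_upper atLeastLessThan_iff pos_mod_bound pos_mod_sign zero_less_numeral zero_less_power)
  thus ?thesis unfolding cores_def by blast
qed

lemma closed_blocks: "closed (blocks n)"
  unfolding blocks_eq_finite_UN by (intro closed_UN) (auto simp: block_eq_Icc)

lemma closed_cores: "closed (cores n)"
  unfolding cores_eq_finite_UN by (intro closed_UN) (auto simp: core_eq_Icc)

lemma blocks_0: "blocks 0 = {0..1}"
  by (simp add: blocks_def)

lemma cores_subset_blocks: "cores n \<subseteq> blocks n"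
  unfolding cores_def blocks_def using core_subset_block by blast

lemma cantor_subset_blocks: "cantor \<subseteq> blocks n"
  unfolding cantor_def using cores_subset_blocks by blast

lemma blocks_forward: "x \<in> blocks n \<Longrightarrow> (fmap ^^ t) x \<in> blocks n"
  unfolding blocks_def using funpow_in_block by blast

lemma core_of_mem_cores: "x \<in> block n k \<Longrightarrow> x \<in> cores n \<Longrightarrow> x \<in> core n k"
  unfolding cores_def using core_subset_block block_eq_mod core_cong by blast

section \<open>Renormalization on \<open>block n 0\<close> and points of the Cantor set\<close>

lemma funpow_emb_lt:
  assumes "x \<in> {0..1}" "t < 2 ^ n"
  shows "(fmap ^^ t) (emb n 0 x) = emb n (int t) x"
  using assms(2)
proof (induction t)
  case (Suc t)
  have "\<not> 2 ^ n dvd int t + 1"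
  proof
    assume "2 ^ n dvd int t + 1"
    hence "2 ^ n \<le> int t + 1" by (rule zdvd_imp_le) simp
    moreover have "int (Suc t) < 2 ^ n"
      using Suc.prems by (metis of_nat_less_iff of_nat_numeral of_nat_power)
    ultimately show False by simp
  qed
  thus ?case using Suc fmap_emb[OF assms(1), of n "int t"] by (simp add: add.commute)
qed simp

text \<open>In \<open>2 ^ n\<close> steps the counter wraps around once with a single full carry, so
  the return map is \<open>fmap\<close> conjugated by \<open>emb n 0\<close>.\<close>

lemma funpow_emb_period:
  assumes "x \<in> {0..1}"
  shows "(fmap ^^ (2 ^ n)) (emb n 0 x) = emb n 0 (fmap x)"
proof -
  have s: "Suc (2 ^ n - 1) = 2 ^ n" by simp
  have i: "int (2 ^ n - 1) = 2 ^ n - 1" by (simp add: of_nat_diff)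
  have "(fmap ^^ (2 ^ n)) (emb n 0 x) = fmap ((fmap ^^ (2 ^ n - 1)) (emb n 0 x))"
    by (metis s funpow.simps(2) comp_apply)
  also have "\<dots> = fmap (emb n (2 ^ n - 1) x)"
    using funpow_emb_lt[OF assms, of "2 ^ n - 1" n] i by simp
  also have "\<dots> = emb n (2 ^ n) (fmap x)" by (simp add: fmap_emb[OF assms])
  also have "emb n (2 ^ n) = emb n 0" by (rule emb_cong) simp
  finally show ?thesis .
qed

lemma funpow_emb_periods:
  assumes "x \<in> {0..1}"
  shows "(fmap ^^ (2 ^ n * s)) (emb n 0 x) = emb n 0 ((fmap ^^ s) x)"
proof (induction s)
  case (Suc s)
  have "(fmap ^^ (2 ^ n * Suc s)) (emb n 0 x) = (fmap ^^ (2 ^ n)) ((fmap ^^ (2 ^ n * s)) (emb n 0 x))"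
    by (simp add: funpow_add)
  thus ?case using Suc funpow_emb_period[OF fmap_funpow_in_unit[OF assms, of s]] by simp
qed simp

lemma fifth_in_cantor: "1/5 \<in> cantor"
proof -
  have "emb n 0 (1/5) = 1/5" for n by (induction n) (auto simp: embL_def)
  hence "1/5 \<in> core n 0" for n unfolding core_def by (intro image_eqI[of _ _ "1/5"]) auto
  thus ?thesis unfolding cantor_def cores_def by blast
qed

lemma emb1_cantor:
  assumes "x \<in> cantor" shows "embL x \<in> cantor" "embR x \<in> cantor"
proof -
  have *: "x \<in> cores n" for n using assms unfolding cantor_def by blast
  have "\<exists>i. x \<in> core n i" for n using *[of n] unfolding cores_def by blast
  then obtain i where i: "x \<in> core n (i n)" for n by metis
  have "embL x \<in> core (Suc n) (2 * i n)" "embR x \<in> core (Suc n) (2 * i n + 1)" for n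
    using i[of n] unfolding core_Suc by auto
  hence "embL x \<in> core n (2 * i n)" "embR x \<in> core n (2 * i n + 1)" for n
    using core_Suc_subset by blast+
  thus "embL x \<in> cantor" "embR x \<in> cantor" unfolding cantor_def cores_def by blast+
qed

lemma emb_cantor: "x \<in> cantor \<Longrightarrow> emb n k x \<in> cantor"
  by (induction n arbitrary: k) (auto simp: emb1_cantor)

text \<open>For every \<open>n\<close> the \<open>2 ^ n\<close> copies of 1/5 lie in pairwise
  disjoint blocks.\<close>

lemma infinite_cantor: "infinite cantor"
proof
  assume fin: "finite cantor"
  have "2 ^ n \<le> card cantor" for n :: nat
  proof -
    let ?g = "\<lambda>k::int. emb n k (1/5)"
    have "?g k \<in> block n k" for k unfolding block_def by auto
    hence "inj_on ?g {0..<2 ^ n}"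
      by (intro inj_onI) (metis block_eq_mod atLeastLessThan_iff mod_pos_pos_trivial)
    moreover have "?g ` {0..<2 ^ n} \<subseteq> cantor"
      using emb_cantor[OF fifth_in_cantor] by blast
    ultimately have "card {0..<2 ^ n :: int} \<le> card cantor" using fin by (metis card_inj_on_le)
    thus ?thesis by (simp add: nat_power_eq)
  qed
  from this[of "card cantor"] show False using less_exp[of "card cantor"] by simp
qed

section \<open>Orbits that enter every level\<close>

lemma deep_blocks: "deep x \<Longrightarrow> \<forall>\<^sub>F t in sequentially. (fmap ^^ t) x \<in> blocks n"
proof -
  assume "deep x"
  then obtain t0 where t0: "(fmap ^^ t0) x \<in> blocks n" unfolding deep_def by blast
  have "(fmap ^^ t) x \<in> blocks n" if "t \<ge> t0" for t
    using blocks_forward[OF t0, of "t - t0"] funpow_split[OF that, of fmap x] by simp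
  thus ?thesis unfolding eventually_sequentially by blast
qed

text \<open>The index of the wandering interval increases with time, so no interval is visited
  twice.\<close>

lemma eventually_not_wander: "\<forall>\<^sub>F t in sequentially. (fmap ^^ t) x \<notin> wander j"
proof (cases "\<exists>t0. (fmap ^^ t0) x \<in> wander j")
  case True
  then obtain t0 where t0: "(fmap ^^ t0) x \<in> wander j" by blast
  have "(fmap ^^ t) x \<notin> wander j" if "t \<ge> Suc t0" for t
  proof -
    have "(fmap ^^ (t - t0)) ((fmap ^^ t0) x) \<in> wander (j + int (t - t0))"
      using t0 by (rule funpow_wander)
    hence "(fmap ^^ t) x \<in> wander (j + int (t - t0))"
      using that funpow_split[of t0 t fmap x] by simp
    moreover have "j + int (t - t0) \<noteq> j" using that by simp
    ultimately show ?thesis using wander_disjoint by blast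
  qed
  thus ?thesis unfolding eventually_sequentially by blast
qed simp

text \<open>Outside its cores, level \<open>n\<close> is covered by finitely many wandering
  intervals, each of which the orbit eventually avoids.\<close>

lemma deep_cores:
  assumes "deep x" shows "\<forall>\<^sub>F t in sequentially. (fmap ^^ t) x \<in> cores n"
proof -
  have "\<forall>\<^sub>F t in sequentially. \<forall>j\<in>{- (2 ^ n)..<2 ^ n}. (fmap ^^ t) x \<notin> wander j"
    by (intro eventually_ball_finite ballI eventually_not_wander) simp
  with deep_blocks[OF assms, of n] show ?thesis
  proof eventually_elim
    case (elim t)
    then obtain k where "(fmap ^^ t) x \<in> block n k" unfolding blocks_def by blast
    thus ?case using elim unfolding cores_def by (elim block_cases) auto
  qed
qed

lemma omega_limit_closed:
  assumes "\<forall>\<^sub>F t in sequentially. (f ^^ t) x \<in> S" "closed S" shows "omega_limit f x \<subseteq> S"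
proof
  fix y assume y: "y \<in> omega_limit f x"
  show "y \<in> S"
  proof (rule ccontr)
    assume "y \<notin> S"
    then obtain e where e: "e > 0" "ball y e \<subseteq> - S"
      using \<open>closed S\<close> by (metis ComplI open_Compl open_contains_ball)
    have "\<exists>\<^sub>F t in sequentially. dist ((f ^^ t) x) y < e"
      using y e(1) unfolding omega_limit_def by blast
    hence "\<exists>\<^sub>F t in sequentially. False"
      by (rule frequently_rev_mp[OF _ eventually_mono[OF assms(1)]])
         (use e(2) in \<open>auto simp: subset_iff dist_commute\<close>)
    thus False by simp
  qed
qed

lemma funpow_visits_block:
  assumes "(fmap ^^ t0) x \<in> blocks n"
  shows "\<exists>t\<ge>T. (fmap ^^ t) x \<in> block n k"
proof -
  obtain l where l: "(fmap ^^ t0) x \<in> block n l" using assms unfolding blocks_def by blast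
  \<comment> \<open>The first summand turns the address \<open>l\<close> into \<open>k\<close>; the
    full turns delay the visit beyond \<open>T\<close>.\<close>
  define s where "s = nat ((k - l) mod 2 ^ n) + 2 ^ n * T"
  have "int s = (k - l) mod 2 ^ n + 2 ^ n * int T" by (simp add: s_def)
  hence "(l + int s) mod 2 ^ n = k mod 2 ^ n"
    by (simp add: mod_simps flip: add.assoc)
  hence "block n (l + int s) = block n k" by (rule block_cong)
  hence "(fmap ^^ (s + t0)) x \<in> block n k"
    using funpow_in_block[OF l, of s] by (simp add: funpow_add)
  moreover have "T \<le> s + t0"
  proof -
    have "T \<le> 2 ^ n * T" by simp
    thus ?thesis unfolding s_def by linarith
  qed
  ultimately show ?thesis by blast
qed

text \<open>The orbit is eventually in the closed set \<open>cores n\<close> for every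
  \<open>n\<close>, which bounds the limit set from above. Conversely every core of level
  \<open>n\<close> is visited at arbitrarily late times and has diameter at most 4^-n.\<close>

lemma omega_limit_deep:
  assumes "deep x" shows "omega_limit fmap x = cantor"
proof
  show "omega_limit fmap x \<subseteq> cantor"
    unfolding cantor_def using omega_limit_closed[OF deep_cores[OF assms] closed_cores] by blast
  show "cantor \<subseteq> omega_limit fmap x"
    unfolding omega_limit_def
  proof (intro subsetI CollectI allI impI)
    fix w e :: real assume w: "w \<in> cantor" and "e > 0"
    then obtain n where n: "(1/4::real) ^ n < e" using real_arch_pow_inv[of e "1/4"] by auto
    obtain k where k: "w \<in> core n k" using w unfolding cantor_def cores_def by blast
    obtain T where T: "\<And>t. t \<ge> T \<Longrightarrow> (fmap ^^ t) x \<in> cores n"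
      using deep_cores[OF assms, of n] unfolding eventually_sequentially by blast
    obtain t0 where t0: "(fmap ^^ t0) x \<in> blocks n" using assms unfolding deep_def by blast
    show "\<exists>\<^sub>F t in sequentially. dist ((fmap ^^ t) x) w < e"
      unfolding frequently_sequentially
    proof
      fix N
      obtain t where t: "t \<ge> max N T" "(fmap ^^ t) x \<in> block n k"
        using funpow_visits_block[OF t0] by blast
      hence "(fmap ^^ t) x \<in> core n k" using T[of t] core_of_mem_cores by simp
      hence "\<bar>(fmap ^^ t) x - w\<bar> \<le> (1/4) ^ n" using k by (rule core_diameter)
      thus "\<exists>t\<ge>N. dist ((fmap ^^ t) x) w < e" using n t(1) by (auto simp: dist_real_def)
    qed
  qed
qed

section \<open>Escape from the gap and eventually periodic orbits\<close>

lemma gap_funpow: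
  assumes "\<And>i. i < t \<Longrightarrow> (fmap ^^ i) x \<in> {2/5<..<3/5}"
  shows "(fmap ^^ t) x = 8/15 + (-7/2) ^ t * (x - 8/15)"
  using assms
proof (induction t)
  case (Suc t)
  hence eq: "(fmap ^^ t) x = 8/15 + (-7/2) ^ t * (x - 8/15)" by simp
  have "(fmap ^^ t) x \<in> {2/5<..<3/5}" using Suc by blast
  hence "(fmap ^^ Suc t) x = 1 - 7/2 * ((fmap ^^ t) x - 2/5)" by (simp add: fmap_gap)
  thus ?case unfolding eq by (simp add: field_simps)
qed simp

text \<open>8/15 is the fixed point of the linear branch; the distance of any other point to it
  grows by the factor 7/2 until the point leaves the gap.\<close>

lemma stays_in_gap:
  assumes "\<And>i. (fmap ^^ i) x \<in> {2/5<..<3/5}"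
  shows "x = 8/15"
proof (rule ccontr)
  assume "x \<noteq> 8/15"
  then obtain t where t: "1 / \<bar>x - 8/15\<bar> < (7/2) ^ t"
    using real_arch_pow[of "7/2" "1 / \<bar>x - 8/15\<bar>"] by auto
  have "1 < (7/2) ^ t * \<bar>x - 8/15\<bar>"
    using t \<open>x \<noteq> 8/15\<close> by (simp add: field_simps)
  also have "\<dots> = \<bar>(fmap ^^ t) x - 8/15\<bar>"
    using gap_funpow[of t x] assms by (simp add: abs_mult power_abs)
  finally show False using assms[of t] unfolding greaterThanLessThan_iff by linarith
qed

lemma fmap_fixpoint: "fmap (8/15) = 8/15"
  by (simp add: fmap_gap)

lemma not_in_gap: "x \<in> {0..1} \<Longrightarrow> x \<notin> {2/5<..<3/5} \<Longrightarrow> x \<in> embL ` {0..1} \<or> x \<in> embR ` {0..1}"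
  unfolding embL_image embR_image by auto

lemma emb_Suc_inner:
  "emb n 0 (embL x) = emb (Suc n) 0 x" "emb n 0 (embR x) = emb (Suc n) (2 ^ n) x"
  by (induction n) auto

text \<open>Let \<open>n\<close> = \<open>m\<close> + 1 be the least level never entered. Some
  iterate lies in \<open>block m 0\<close>, and its renormalized orbit never leaves the gap, as
  leaving would mean entering level \<open>n\<close>. So it is the copy of the fixed point 8/15,
  which returns after \<open>2 ^ m\<close> steps.\<close>

lemma not_deep_periodic:
  assumes "x \<in> {0..1}" "\<not> deep x"
  obtains n T q p where "\<And>t. (fmap ^^ t) x \<notin> blocks n" "(fmap ^^ T) x = q" "p > 0" "(fmap ^^ p) q = q"
proof -
  define n where "n = (LEAST n. \<forall>t. (fmap ^^ t) x \<notin> blocks n)"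
  have ex: "\<exists>n. \<forall>t. (fmap ^^ t) x \<notin> blocks n"
    using assms(2) unfolding deep_def by blast
  have n: "\<And>t. (fmap ^^ t) x \<notin> blocks n" using LeastI_ex[OF ex] unfolding n_def by blast
  have "n \<noteq> 0" using n[of 0] assms(1) by (metis blocks_0 funpow_0)
  then obtain m where m: "n = Suc m" by (cases n) auto
  have "\<not> (\<forall>t. (fmap ^^ t) x \<notin> blocks m)"
    using not_less_Least[of m "\<lambda>n. \<forall>t. (fmap ^^ t) x \<notin> blocks n"] m
      unfolding n_def by auto
  then obtain t0 where "(fmap ^^ t0) x \<in> blocks m" by blast
  then obtain T where "(fmap ^^ T) x \<in> block m 0" using funpow_visits_block by blast
  then obtain y where y: "y \<in> {0..1}" "(fmap ^^ T) x = emb m 0 y" unfolding block_def by blast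
  have "(fmap ^^ s) y \<in> {2/5<..<3/5}" for s
  proof (rule ccontr)
    assume "(fmap ^^ s) y \<notin> {2/5<..<3/5}"
    with fmap_funpow_in_unit[OF y(1), of s] obtain z where
      z: "z \<in> {0..1}" "(fmap ^^ s) y = embL z \<or> (fmap ^^ s) y = embR z"
      using not_in_gap by blast
    have "(fmap ^^ (2 ^ m * s + T)) x = emb m 0 ((fmap ^^ s) y)"
      using funpow_emb_periods[OF y(1), of m s] by (simp add: funpow_add y(2))
    also have "\<dots> \<in> blocks n"
    proof -
      have "emb m 0 (embL z) \<in> block n 0" "emb m 0 (embR z) \<in> block n (2 ^ m)"
        unfolding m block_def emb_Suc_inner using z(1) by blast+
      thus ?thesis using z(2) unfolding blocks_def by auto
    qed
    finally show False using n by blast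
  qed
  hence "y = 8/15" by (rule stays_in_gap)
  hence "(fmap ^^ (2 ^ m)) (emb m 0 y) = emb m 0 y"
    using funpow_emb_period[OF y(1)] fmap_fixpoint by metis
  thus thesis using that[of n T "emb m 0 y" "2 ^ m"] n y by simp
qed

lemma periodic_orbit_finite:
  assumes "(f ^^ T) x = q" "p > 0" "(f ^^ p) q = q"
  shows "\<exists>P. finite P \<and> (\<forall>t\<ge>T. (f ^^ t) x \<in> P) \<and> P \<subseteq> range (\<lambda>t. (f ^^ t) x)"
proof (intro exI conjI allI impI)
  let ?P = "(\<lambda>i. (f ^^ (i + T)) x) ` {..<p}"
  show "finite ?P" by simp
  show "?P \<subseteq> range (\<lambda>t. (f ^^ t) x)" by blast
  fix t assume "t \<ge> T"
  hence "(f ^^ t) x = (f ^^ (t - T)) q"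
    unfolding assms(1)[symmetric] by (rule funpow_split)
  also have "\<dots> = (f ^^ ((t - T) mod p)) q" using assms(3) by (simp add: funpow_mod_eq)
  also have "\<dots> = (f ^^ ((t - T) mod p + T)) x" by (simp add: funpow_add assms(1))
  finally show "(f ^^ t) x \<in> ?P" using assms(2) by auto
qed

lemma omega_limit_not_deep:
  assumes "x \<in> {0..1}" "\<not> deep x" shows "finite (omega_limit fmap x)"
proof -
  obtain n T q p where "\<And>t. (fmap ^^ t) x \<notin> blocks n"
    and per: "(fmap ^^ T) x = q" "p > 0" "(fmap ^^ p) q = q"
    by (rule not_deep_periodic[OF assms]) blast
  obtain P where P: "finite P" "\<forall>t\<ge>T. (fmap ^^ t) x \<in> P"
    using periodic_orbit_finite[OF per] by blast
  hence "\<forall>\<^sub>F t in sequentially. (fmap ^^ t) x \<in> P"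
    unfolding eventually_sequentially by blast
  hence "omega_limit fmap x \<subseteq> P"
    by (rule omega_limit_closed) (rule finite_imp_closed[OF P(1)])
  thus ?thesis using P(1) finite_subset by blast
qed

lemma deep_fifth: "deep (1/5)"
  unfolding deep_def using fifth_in_cantor cantor_subset_blocks by (metis funpow_0 subsetD)

section \<open>The associated system\<close>

lemma block_periodic_interval: "periodic_interval fmap (2 ^ n) (block n k)"
  unfolding periodic_interval_def
proof (intro conjI allI impI)
  show "compact_interval (block n k)"
    unfolding compact_interval_def block_eq_Icc
      by (intro exI[of _ "emb n k 0"] exI[of _ "emb n k 1"]) simp
  show "block n k \<subseteq> unitI" by (rule block_subset_unit)
  show "(1::nat) \<le> 2 ^ n" by simp
  show "(fmap ^^ 2 ^ n) ` block n k = block n k"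
    unfolding funpow_block by (rule block_cong) simp
  fix i j :: nat assume ij: "i < 2 ^ n" "j < 2 ^ n" "i \<noteq> j"
  have "(k + int i) mod 2 ^ n \<noteq> (k + int j) mod 2 ^ n"
  proof
    assume "(k + int i) mod 2 ^ n = (k + int j) mod 2 ^ n"
    hence "int i mod 2 ^ n = int j mod 2 ^ n" by (simp add: mod_eq_dvd_iff)
    moreover have "int i < 2 ^ n" "int j < 2 ^ n"
      using ij by (metis of_nat_less_iff of_nat_numeral of_nat_power)+
    ultimately show False using ij by simp
  qed
  thus "(fmap ^^ i) ` block n k \<inter> (fmap ^^ j) ` block n k = {}"
    unfolding funpow_block by (rule block_disjoint)
qed

lemma UN_block_shift: "(\<Union>i<2 ^ n. block n (r + int i)) = blocks n"
proof
  show "blocks n \<subseteq> (\<Union>i<2 ^ n. block n (r + int i))"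
  proof
    fix x assume "x \<in> blocks n"
    then obtain k where k: "x \<in> block n k" unfolding blocks_def by blast
    define i where "i = nat ((k - r) mod 2 ^ n)"
    have i: "int i = (k - r) mod 2 ^ n" by (simp add: i_def)
    have "block n (r + int i) = block n k"
      by (rule block_cong) (simp add: i mod_simps)
    moreover have "i < 2 ^ n"
    proof -
      have "int i < 2 ^ n" unfolding i by simp
      thus ?thesis by (metis of_nat_less_iff of_nat_numeral of_nat_power)
    qed
    ultimately show "x \<in> (\<Union>i<2 ^ n. block n (r + int i))" using k by blast
  qed
qed (auto simp: blocks_def)

lemma block_covers_cantor: "cantor \<subseteq> (\<Union>i<2 ^ n. (fmap ^^ i) ` block n k)"
  unfolding funpow_block UN_block_shift by (rule cantor_subset_blocks)

text \<open>The orbit of a covering interval meets \<open>1/5\<close>; the first return of \<open>1/5\<close> lies beyond the point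
  \<open>emb n 0 (2/5)\<close>, which the next two returns send to the two endpoints of \<open>block n 0\<close>.\<close>

lemma periodic_interval_contains_block:
  assumes K: "periodic_interval fmap (2 ^ n) K"
    and cover: "cantor \<subseteq> (\<Union>i<2 ^ n. (fmap ^^ i) ` K)"
  obtains r where "block n r \<subseteq> K"
proof -
  let ?p = "2 ^ n :: nat"
  obtain i where i: "i < ?p" "1/5 \<in> (fmap ^^ i) ` K" using cover fifth_in_cantor by blast
  let ?K = "(fmap ^^ i) ` K"
  have K1: "connected K" "K \<subseteq> {0..1}" "(fmap ^^ ?p) ` K = K"
    using K unfolding periodic_interval_def compact_interval_def by auto
  have cont: "continuous_on {0..1} (fmap ^^ j)" for j
  proof (induction j)
    case (Suc j)
    have "continuous_on {0..1} (fmap \<circ> (fmap ^^ j))"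
      by (intro continuous_on_compose Suc continuous_on_subset[OF continuous_fmap])
        (use fmap_funpow_in_unit in blast)
    thus ?case by simp
  qed (auto intro: continuous_on_id)
  have conn: "connected ?K"
    using K1(1) by (intro connected_continuous_image continuous_on_subset[OF cont K1(2)])
  have "(fmap ^^ ?p) ` ?K = (fmap ^^ i) ` (fmap ^^ ?p) ` K"
    unfolding image_comp by (simp only: funpow_add[symmetric] add.commute)
  hence ret: "(fmap ^^ ?p) x \<in> ?K" if "x \<in> ?K" for x using that K1(3) by blast
  have ret': "emb n 0 (fmap y) \<in> ?K" if "emb n 0 y \<in> ?K" "y \<in> {0..1}" for y
    using ret[OF that(1)] funpow_emb_period[OF that(2), of n] by simp
  have "emb n 0 (1/5) = 1/5" by (induction n) (auto simp: embL_def)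
  hence e: "emb n 0 (1/5) \<in> ?K" using i(2) by metis
  have "fmap (1/5) = 13/20" by (simp add: fmap.simps[of "1/5"] embR_def)
  moreover have "emb n 0 (fmap (1/5)) \<in> ?K" using ret'[OF e] by simp
  ultimately have "emb n 0 (13/20) \<in> ?K" by metis
  hence "{emb n 0 (1/5)..emb n 0 (13/20)} \<subseteq> ?K"
    using connected_contains_Icc[OF conn e] by blast
  moreover have "emb n 0 (2/5) \<in> {emb n 0 (1/5)..emb n 0 (13/20)}" by simp
  ultimately have "emb n 0 (2/5) \<in> ?K" by blast
  from ret'[OF this] have one: "emb n 0 1 \<in> ?K" by (simp add: fmap_two_fifths)
  from ret'[OF this] have zero: "emb n 0 0 \<in> ?K" by (simp add: fmap_one)
  have "block n 0 \<subseteq> ?K"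
    unfolding block_eq_Icc using connected_contains_Icc[OF conn zero one] .
  \<comment> \<open>The remaining \<open>2 ^ n - i\<close> steps complete the period: they bring
    \<open>?K\<close> back to \<open>K\<close> and turn \<open>block n 0\<close> into another
    block.\<close>
  hence "(fmap ^^ (?p - i)) ` block n 0 \<subseteq> (fmap ^^ (?p - i)) ` ?K" by (rule image_mono)
  also have "\<dots> = K"
    using K1(3) i(1) by (simp add: image_comp flip: funpow_add)
  finally show thesis using that unfolding funpow_block by blast
qed

text \<open>A competitor \<open>L\<close> contains some block, and since it lies in
  \<open>block n k\<close>, disjointness leaves only \<open>block n k\<close> itself.\<close>

lemma minimal_periodic_block: "minimal_periodic_interval fmap (2 ^ n) cantor (block n k)"
  unfolding minimal_periodic_interval_def
proof (intro conjI allI impI)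
  fix L assume L: "L \<subseteq> block n k \<and> periodic_interval fmap (2 ^ n) L \<and>
    cantor \<subseteq> (\<Union>i<2 ^ n. (fmap ^^ i) ` L)"
  obtain r where r: "block n r \<subseteq> L"
    using L periodic_interval_contains_block[of n L] by blast
  have "emb n r 0 \<in> block n r" by (simp add: block_def)
  hence "k mod 2 ^ n = r mod 2 ^ n" using L r block_eq_mod by blast
  hence "block n k = block n r" by (rule block_cong)
  thus "L = block n k" using L r by blast
qed (rule block_periodic_interval block_covers_cantor)+

text \<open>The block found inside \<open>K\<close> is itself a competitor, so minimality makes it
  equal to \<open>K\<close>.\<close>

lemma minimal_periodic_is_block:
  assumes "minimal_periodic_interval fmap (2 ^ n) cantor K"
  obtains r where "K = block n r"
proof -
  have K: "periodic_interval fmap (2 ^ n) K" "cantor \<subseteq> (\<Union>i<2 ^ n. (fmap ^^ i) ` K)"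
    and minimal: "\<And>L. L \<subseteq> K \<Longrightarrow> periodic_interval fmap (2 ^ n) L \<Longrightarrow>
      cantor \<subseteq> (\<Union>i<2 ^ n. (fmap ^^ i) ` L) \<Longrightarrow> L = K"
    using assms unfolding minimal_periodic_interval_def by blast+
  obtain r where "block n r \<subseteq> K" using K by (rule periodic_interval_contains_block)
  hence "block n r = K" by (rule minimal[OF _ block_periodic_interval block_covers_cantor])
  thus thesis using that by blast
qed

lemma assoc_system_blocks: "assoc_system fmap cantor (\<lambda>n k. block n (int k))"
  unfolding assoc_system_def
proof (intro allI conjI impI)
  fix n k :: nat
  show "minimal_periodic_interval fmap (2 ^ n) cantor (block n (int 0))"
    by (rule minimal_periodic_block)
  show "compact_interval (block n (int k))"
    using block_periodic_interval unfolding periodic_interval_def by blast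
  show "fmap ` block n (int k) = block n (int ((k + 1) mod 2 ^ n))"
    unfolding fmap_block by (rule block_cong) (simp add: zmod_int add.commute)
  show "cantor \<subseteq> (\<Union>k<2 ^ n. block n (int k))"
    using UN_block_shift[of n 0] cantor_subset_blocks by simp
  show "block (Suc n) (int 0) \<subseteq> block n (int 0)" by (rule block_Suc_subset)
qed

text \<open>An associated system may start at any block of a level, and the dynamics then produces
  all the others, so the union does not depend on the choice. This reduces the claims about all
  systems to one set.\<close>

lemma simple_set_eq:
  assumes "assoc_system fmap cantor J" shows "simple_set J = (\<Inter>n. blocks n)"
proof -
  have "(\<Union>k<2 ^ n. J n k) = blocks n" for n
  proof -
    have J: "minimal_periodic_interval fmap (2 ^ n) cantor (J n 0)"
      "\<And>k. k < 2 ^ n \<Longrightarrow> fmap ` J n k = J n ((k + 1) mod 2 ^ n)"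
      using assms unfolding assoc_system_def by blast+
    obtain r where r: "J n 0 = block n r" using J(1) by (rule minimal_periodic_is_block)
    have "J n k = block n (r + int k)" if "k < 2 ^ n" for k
      using that
    proof (induction k)
      case (Suc k)
      hence "J n (Suc k) = fmap ` J n k" using J(2)[of k] by simp
      thus ?case using Suc by (simp add: fmap_block ac_simps)
    qed (simp add: r)
    thus ?thesis using UN_block_shift[of n r] by simp
  qed
  thus ?thesis by (simp add: simple_set_def)
qed

section \<open>Connected components of the simple set\<close>

lemma wander_subset_blocks: "wander j \<subseteq> (\<Inter>n. blocks n)"
  unfolding wander_def blocks_def by blast

text \<open>A level is a finite disjoint union of closed blocks, so a connected subset meets only
  one of them.\<close>

lemma connected_subset_block:
  assumes "connected T" "T \<subseteq> blocks n" "x \<in> T" "x \<in> block n k"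
  shows "T \<subseteq> block n k"
proof -
  let ?R = "\<Union>l\<in>{0..<2 ^ n} - {k mod 2 ^ n}. block n l"
  have closed: "closed (block n k)" "closed ?R"
    by (simp add: block_eq_Icc, intro closed_UN) (auto simp: block_eq_Icc)
  have "block n k \<inter> block n l = {}" if "l \<in> {0..<2 ^ n} - {k mod 2 ^ n}" for l
    using that by (intro block_disjoint) auto
  hence disj: "block n k \<inter> ?R = {}" by blast
  have cov: "T \<subseteq> block n k \<union> ?R"
    using assms(2) block_mod[of n k] unfolding blocks_eq_finite_UN by blast
  have "?R \<inter> T = {}"
  proof (rule ccontr)
    assume "?R \<inter> T \<noteq> {}"
    thus False
      using connected_closedD[OF assms(1), of "block n k" ?R] closed cov disj assms(3,4) by blast
  qed
  thus ?thesis using cov by blast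
qed

lemma component_wander:
  assumes "x \<in> wander j"
  shows "connected_component_set (\<Inter>n. blocks n) x = wander j"
proof
  let ?M = "\<Inter>n. blocks n"
  have "connected_component_set ?M x \<subseteq> block n j" for n
  proof (rule connected_subset_block)
    show "connected_component_set ?M x \<subseteq> blocks n"
      using connected_component_subset[of ?M x] by blast
    show "x \<in> connected_component_set ?M x" using assms wander_subset_blocks by auto
    show "x \<in> block n j" using assms unfolding wander_def by blast
  qed simp
  thus "connected_component_set ?M x \<subseteq> wander j" unfolding wander_def by blast
  have "connected (wander j)" using wander_Icc[of j] by auto
  thus "wander j \<subseteq> connected_component_set ?M x"
    by (rule connected_component_maximal[OF assms]) (rule wander_subset_blocks)
qed

text \<open>Two distinct points of a component share a block of every level. Once 4^-n is below
  their distance they cannot both lie in its core, so one of them is in a wandering interval, which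
  is then the whole component.\<close>

lemma nondeg_components_eq: "nondeg_components (\<Inter>n. blocks n) = range wander"
proof
  let ?M = "\<Inter>n. blocks n"
  show "range wander \<subseteq> nondeg_components ?M"
  proof
    fix C assume "C \<in> range wander"
    then obtain j where j: "C = wander j" by blast
    obtain x y where xy: "x \<in> C" "y \<in> C" "x \<noteq> y"
      using wander_nondegenerate[of j] j by blast
    have "x \<in> ?M" using xy(1) j wander_subset_blocks by blast
    moreover have "C = connected_component_set ?M x" using component_wander xy(1) j by simp
    ultimately show "C \<in> nondeg_components ?M" unfolding nondeg_components_def using xy by blast
  qed
  show "nondeg_components ?M \<subseteq> range wander"
  proof
    fix C assume "C \<in> nondeg_components ?M"
    then obtain x where x: "x \<in> ?M" "C = connected_component_set ?M x" "\<not> (\<exists>a. C = {a})"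
      unfolding nondeg_components_def by blast
    have "x \<in> C" using x by auto
    then obtain y where y: "y \<in> C" "y \<noteq> x" using x(3) by blast
    obtain n where n: "(1/4::real) ^ n < \<bar>x - y\<bar>"
      using real_arch_pow_inv[of "\<bar>x - y\<bar>" "1/4"] y by auto
    obtain k where k: "x \<in> block n k" using x(1) unfolding blocks_def by blast
    have CM: "connected C" "C \<subseteq> ?M"
      unfolding x(2) by (simp, rule connected_component_subset)
    have "C \<subseteq> block n k"
      by (rule connected_subset_block[OF CM(1) _ \<open>x \<in> C\<close> k]) (use CM(2) in blast)
    hence yk: "y \<in> block n k" using y by blast
    have "\<not> (x \<in> core n k \<and> y \<in> core n k)"
      using core_diameter[of x n k y] n by auto
    then obtain z j where z: "z \<in> C" "z \<in> wander j"
      using block_cases[OF k] block_cases[OF yk] \<open>x \<in> C\<close> y(1) by metis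
    have "C = connected_component_set ?M z"
      using z(1) connected_component_eq unfolding x(2) by metis
    thus "C \<in> range wander" using component_wander[OF z(2)] by blast
  qed
qed

lemma inj_wander: "inj wander"
proof (rule injI, rule ccontr)
  fix i j assume "wander i = wander j" "i \<noteq> j"
  thus False using wander_disjoint[of i j] wander_nondegenerate[of i] by auto
qed

lemma interior_blocks: "interior (\<Inter>n. blocks n) \<noteq> {}"
proof -
  have "{0<..<1/5} \<subseteq> {0..1/5::real}" by auto
  also have "\<dots> \<subseteq> wander 0" by (rule fifth_in_wander)
  also have "\<dots> \<subseteq> (\<Inter>n. blocks n)" by (rule wander_subset_blocks)
  finally have "{0<..<1/5} \<subseteq> (\<Inter>n. blocks n)" .
  hence "{0<..<1/5} \<subseteq> interior (\<Inter>n. blocks n)" by (rule interior_maximal) simp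
  moreover have "1/10 \<in> {0<..<1/5::real}" by simp
  ultimately show ?thesis by blast
qed

section \<open>Absence of Li-Yorke pairs\<close>

lemma liminf_zero_frequently:
  fixes d :: "nat \<Rightarrow> real"
  assumes "liminf (\<lambda>n. ereal (d n)) = 0" "e > 0"
  shows "\<exists>\<^sub>F n in sequentially. d n < e"
proof (rule ccontr)
  assume "\<not> ?thesis"
  hence "\<forall>\<^sub>F n in sequentially. ereal e \<le> ereal (d n)"
    unfolding not_frequently by (simp add: not_less)
  hence "ereal e \<le> liminf (\<lambda>n. ereal (d n))" by (rule Liminf_bounded)
  thus False using assms by simp
qed

lemma limsup_nonpos:
  fixes d :: "nat \<Rightarrow> real"
  assumes "\<And>e. e > 0 \<Longrightarrow> \<forall>\<^sub>F n in sequentially. d n \<le> e"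
  shows "limsup (\<lambda>n. ereal (d n)) \<le> 0"
proof (rule ereal_le_epsilon2)
  fix e :: real assume "e > 0"
  hence "\<forall>\<^sub>F n in sequentially. ereal (d n) \<le> ereal e" using assms by simp
  hence "limsup (\<lambda>n. ereal (d n)) \<le> ereal e" by (rule Limsup_bounded)
  thus "limsup (\<lambda>n. ereal (d n)) \<le> 0 + ereal e" by simp
qed

lemma separate_compact_sets:
  fixes S T :: "real set"
  assumes "compact S" "closed T" "S \<inter> T = {}"
  obtains d where "d > 0" "\<And>x y. x \<in> S \<Longrightarrow> y \<in> T \<Longrightarrow> d \<le> \<bar>x - y\<bar>"
  using separate_compact_closed[OF assms] by (auto simp: dist_real_def)

lemma distinct_blocks_separated:
  obtains d where "d > 0"
    "\<And>k l x y. k mod 2 ^ n \<noteq> l mod 2 ^ n \<Longrightarrow> x \<in> block n k \<Longrightarrow> y \<in> block n l \<Longrightarrow> d \<le> \<bar>x - y\<bar>"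
proof -
  let ?I = "{(k, l). k \<in> {0..<2 ^ n} \<and> l \<in> {0..<2 ^ n} \<and> k \<noteq> (l::int)}"
  have fin: "finite ?I" by (rule finite_subset[of _ "{0..<2 ^ n} \<times> {0..<2 ^ n}"]) auto
  have "\<exists>d>0. \<forall>x\<in>block n k. \<forall>y\<in>block n l. d \<le> \<bar>x - y\<bar>" if "(k, l) \<in> ?I" for k l
  proof -
    have "block n k \<inter> block n l = {}" using that by (intro block_disjoint) auto
    moreover have "compact (block n k)" "closed (block n l)" by (simp_all add: block_eq_Icc)
    ultimately obtain d where "d > 0" "\<And>x y. x \<in> block n k \<Longrightarrow> y \<in> block n l \<Longrightarrow> d \<le> \<bar>x - y\<bar>"
      using separate_compact_sets[of "block n k" "block n l"] by blast
    thus ?thesis by blast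
  qed
  hence "\<forall>p\<in>?I. \<exists>d>0. \<forall>x\<in>block n (fst p). \<forall>y\<in>block n (snd p). d \<le> \<bar>x - y\<bar>"
    by (simp only: split_paired_All fst_conv snd_conv Ball_def) blast
  from bchoice[OF this] obtain d where
    D: "\<forall>p\<in>?I. d p > 0 \<and> (\<forall>x\<in>block n (fst p). \<forall>y\<in>block n (snd p). d p \<le> \<bar>x - y\<bar>)"
    by (rule exE)
  have d: "d p > 0" "x \<in> block n (fst p) \<Longrightarrow> y \<in> block n (snd p) \<Longrightarrow> d p \<le> \<bar>x - y\<bar>"
    if "p \<in> ?I" for p x y
    using bspec[OF D that] by blast+
  \<comment> \<open>Inserting 1 keeps the minimum defined for \<open>n\<close> = 0, when there are
    no pairs of distinct blocks.\<close>
  define m where "m = Min (insert 1 (d ` ?I))"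
  show thesis
  proof (rule that[of m])
    show "m > 0" unfolding m_def using fin d(1) by (subst Min_gr_iff) auto
    fix k l x y assume *: "k mod 2 ^ n \<noteq> l mod 2 ^ n" "x \<in> block n k" "y \<in> block n l"
    let ?p = "(k mod 2 ^ n, l mod 2 ^ n)"
    have p: "?p \<in> ?I" using *(1) by simp
    have "m \<le> d ?p" unfolding m_def using fin p by (intro Min_le) auto
    also have "\<dots> \<le> \<bar>x - y\<bar>" using d(2)[OF p] *(2,3) by (simp add: block_mod)
    finally show "m \<le> \<bar>x - y\<bar>" .
  qed
qed

lemma frequently_eventually_ex:
  assumes "\<exists>\<^sub>F t in F. P t" "\<forall>\<^sub>F t in F. Q t" shows "\<exists>t. P t \<and> Q t"
  using frequently_ex[OF frequently_eventually_conj[OF assms]] by blast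

text \<open>Being closer once than the separation of distinct blocks puts both iterates in the same
  block of level \<open>n\<close>. From then on they travel together, eventually inside a common
  core of diameter at most 4^-n.\<close>

lemma deep_deep_asymptotic:
  assumes "deep x" "deep y" "e > 0"
    and close: "\<And>e. e > 0 \<Longrightarrow> \<exists>\<^sub>F t in sequentially. \<bar>(fmap ^^ t) x - (fmap ^^ t) y\<bar> < e"
  shows "\<forall>\<^sub>F t in sequentially. \<bar>(fmap ^^ t) x - (fmap ^^ t) y\<bar> \<le> e"
proof -
  obtain n where n: "(1/4::real) ^ n < e"
    using real_arch_pow_inv[of e "1/4"] \<open>e > 0\<close> by auto
  obtain d where d: "d > 0"
    "\<And>k l x y. k mod 2 ^ n \<noteq> l mod 2 ^ n \<Longrightarrow> x \<in> block n k \<Longrightarrow> y \<in> block n l \<Longrightarrow> d \<le> \<bar>x - y\<bar>"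
    using distinct_blocks_separated[of n] by metis
  obtain t0 where t0: "\<bar>(fmap ^^ t0) x - (fmap ^^ t0) y\<bar> < d" "(fmap ^^ t0) x \<in> blocks n" "(fmap ^^ t0) y \<in> blocks n"
    using frequently_eventually_ex[OF close[OF d(1)] eventually_conj[OF
        deep_blocks[OF assms(1), of n] deep_blocks[OF assms(2), of n]]] by blast
  obtain k l where kl: "(fmap ^^ t0) x \<in> block n k" "(fmap ^^ t0) y \<in> block n l"
    using t0 unfolding blocks_def by blast
  have "k mod 2 ^ n = l mod 2 ^ n" using d(2)[OF _ kl] t0(1) by fastforce
  hence l: "(fmap ^^ t0) y \<in> block n k" using kl(2) block_cong by metis
  have "\<forall>\<^sub>F t in sequentially. t0 \<le> t" by (rule eventually_ge_at_top)
  with deep_cores[OF assms(1), of n] deep_cores[OF assms(2), of n] show ?thesis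
  proof eventually_elim
    case (elim t)
    have "(fmap ^^ t) x \<in> block n (k + int (t - t0))" "(fmap ^^ t) y \<in> block n (k + int (t - t0))"
      using funpow_in_block[OF kl(1), of "t - t0"] funpow_in_block[OF l, of "t - t0"]
        funpow_split[OF elim(3), of fmap] by auto
    hence "(fmap ^^ t) x \<in> core n (k + int (t - t0))" "(fmap ^^ t) y \<in> core n (k + int (t - t0))"
      using elim core_of_mem_cores by blast+
    hence "\<bar>(fmap ^^ t) x - (fmap ^^ t) y\<bar> \<le> (1/4) ^ n" by (rule core_diameter)
    thus ?case using n by simp
  qed
qed

text \<open>One orbit ends in a finite set disjoint from the closed set \<open>blocks n\<close>, the
  other ends inside \<open>blocks n\<close>.\<close>

lemma not_deep_separated_from_deep:
  assumes "x \<in> {0..1}" "\<not> deep x" "deep y"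
  shows "\<exists>d>0. \<forall>\<^sub>F t in sequentially. d \<le> \<bar>(fmap ^^ t) x - (fmap ^^ t) y\<bar>"
proof -
  obtain n T q p where n: "\<And>t. (fmap ^^ t) x \<notin> blocks n"
    and per: "(fmap ^^ T) x = q" "p > 0" "(fmap ^^ p) q = q"
    by (rule not_deep_periodic[OF assms(1,2)]) blast
  obtain P where P: "finite P" "\<forall>t\<ge>T. (fmap ^^ t) x \<in> P" "P \<subseteq> range (\<lambda>t. (fmap ^^ t) x)"
    using periodic_orbit_finite[OF per] by blast
  have "P \<inter> blocks n = {}" using P(3) n by blast
  then obtain d where d: "d > 0" "\<And>u v. u \<in> P \<Longrightarrow> v \<in> blocks n \<Longrightarrow> d \<le> \<bar>u - v\<bar>"
    using separate_compact_sets[OF finite_imp_compact[OF P(1)] closed_blocks] by blast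
  have "\<forall>\<^sub>F t in sequentially. T \<le> t" by (rule eventually_ge_at_top)
  with deep_blocks[OF assms(3), of n]
  have "\<forall>\<^sub>F t in sequentially. d \<le> \<bar>(fmap ^^ t) x - (fmap ^^ t) y\<bar>"
    by eventually_elim (use d(2) P(2) in blast)
  thus ?thesis using d(1) by blast
qed

text \<open>Both tails run in finite sets, so sufficient closeness at one late time forces equality,
  which then persists.\<close>

lemma not_deep_not_deep_merge:
  assumes "x \<in> {0..1}" "\<not> deep x" "y \<in> {0..1}" "\<not> deep y"
    and close: "\<And>e. e > 0 \<Longrightarrow> \<exists>\<^sub>F t in sequentially. \<bar>(fmap ^^ t) x - (fmap ^^ t) y\<bar> < e"
  shows "\<forall>\<^sub>F t in sequentially. (fmap ^^ t) x = (fmap ^^ t) y"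
proof -
  obtain n T q p where "\<And>t. (fmap ^^ t) x \<notin> blocks n"
    and per: "(fmap ^^ T) x = q" "p > 0" "(fmap ^^ p) q = q"
    by (rule not_deep_periodic[OF assms(1,2)]) blast
  obtain P where P: "finite P" "\<forall>t\<ge>T. (fmap ^^ t) x \<in> P"
    using periodic_orbit_finite[OF per] by blast
  obtain n' T' q' p' where "\<And>t. (fmap ^^ t) y \<notin> blocks n'"
    and per': "(fmap ^^ T') y = q'" "p' > 0" "(fmap ^^ p') q' = q'"
    by (rule not_deep_periodic[OF assms(3,4)]) blast
  obtain P' where P': "finite P'" "\<forall>t\<ge>T'. (fmap ^^ t) y \<in> P'"
    using periodic_orbit_finite[OF per'] by blast
  have "\<exists>d>0. \<forall>z\<in>P \<union> P'. z \<noteq> u \<longrightarrow> d \<le> dist u z" for u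
    using finite_set_avoid[of "P \<union> P'" u] P(1) P'(1) by simp
  then obtain d where d: "\<And>u. d u > 0" "\<And>u z. z \<in> P \<union> P' \<Longrightarrow> z \<noteq> u \<Longrightarrow> d u \<le> dist u z"
    by metis
  define m where "m = Min (insert 1 (d ` P))"
  have m: "m > 0" unfolding m_def using P(1) d(1) by (subst Min_gr_iff) auto
  have "\<forall>\<^sub>F t in sequentially. max T T' \<le> t" by (rule eventually_ge_at_top)
  from frequently_eventually_ex[OF close[OF m] this]
  obtain t0 where t0: "\<bar>(fmap ^^ t0) x - (fmap ^^ t0) y\<bar> < m" "T \<le> t0" "T' \<le> t0"
    by auto
  have "(fmap ^^ t0) x = (fmap ^^ t0) y"
  proof (rule ccontr)
    assume "(fmap ^^ t0) x \<noteq> (fmap ^^ t0) y"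
    moreover have xP: "(fmap ^^ t0) x \<in> P" and "(fmap ^^ t0) y \<in> P'" using t0 P P' by auto
    ultimately have "d ((fmap ^^ t0) x) \<le> \<bar>(fmap ^^ t0) x - (fmap ^^ t0) y\<bar>"
      using d(2)[of "(fmap ^^ t0) y" "(fmap ^^ t0) x"] by (auto simp: dist_real_def)
    moreover have "m \<le> d ((fmap ^^ t0) x)" unfolding m_def using P(1) xP by (intro Min_le) auto
    ultimately show False using t0 by linarith
  qed
  hence "(fmap ^^ t) x = (fmap ^^ t) y" if "t \<ge> t0" for t
    using funpow_split[OF that, of fmap] by metis
  thus ?thesis unfolding eventually_sequentially by blast
qed

text \<open>A vanishing lower limit excludes the mixed case; two deep orbits are then asymptotic,
  and two others merge.\<close>

lemma no_li_yorke_pair: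
  assumes "x \<in> {0..1}" "y \<in> {0..1}"
    and "liminf (\<lambda>n. ereal \<bar>(fmap ^^ n) x - (fmap ^^ n) y\<bar>) = 0"
  shows "limsup (\<lambda>n. ereal \<bar>(fmap ^^ n) x - (fmap ^^ n) y\<bar>) \<le> 0"
proof (rule limsup_nonpos)
  fix e :: real assume e: "e > 0"
  have close: "\<exists>\<^sub>F t in sequentially. \<bar>(fmap ^^ t) x - (fmap ^^ t) y\<bar> < e" if "e > 0" for e
    using liminf_zero_frequently[OF assms(3) that] .
  have no_sep: "\<not> (\<exists>d>0. \<forall>\<^sub>F t in sequentially. d \<le> \<bar>(fmap ^^ t) x - (fmap ^^ t) y\<bar>)"
    using frequently_eventually_ex[OF close] by (meson not_less)
  have no_sep': "\<not> (\<exists>d>0. \<forall>\<^sub>F t in sequentially. d \<le> \<bar>(fmap ^^ t) y - (fmap ^^ t) x\<bar>)"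
    using no_sep by (simp add: abs_minus_commute)
  consider "deep x" "deep y" | "\<not> deep x" "\<not> deep y"
    using not_deep_separated_from_deep[OF assms(1)] not_deep_separated_from_deep[OF assms(2)]
      no_sep no_sep' by blast
  thus "\<forall>\<^sub>F t in sequentially. \<bar>(fmap ^^ t) x - (fmap ^^ t) y\<bar> \<le> e"
  proof cases
    case 1
    thus ?thesis using deep_deep_asymptotic[OF _ _ e close] by blast
  next
    case 2
    show ?thesis
      using not_deep_not_deep_merge[OF assms(1) 2(1) assms(2) 2(2) close]
      by (rule eventually_mono) (use e in auto)
  qed
qed

lemma not_li_yorke_chaotic: "\<not> li_yorke_chaotic fmap"
proof
  assume "li_yorke_chaotic fmap"
  then obtain S where S: "S \<subseteq> unitI" "uncountable S"
    "\<And>x y. x \<in> S \<Longrightarrow> y \<in> S \<Longrightarrow> x \<noteq> y \<Longrightarrow> limsup (\<lambda>n. ereal \<bar>(fmap ^^ n) x - (fmap ^^ n) y\<bar>) > 0 \<and>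
        liminf (\<lambda>n. ereal \<bar>(fmap ^^ n) x - (fmap ^^ n) y\<bar>) = 0"
    unfolding li_yorke_chaotic_def by blast
  have "\<exists>x\<in>S. \<exists>y\<in>S. x \<noteq> y"
  proof (rule ccontr)
    assume "\<not> (\<exists>x\<in>S. \<exists>y\<in>S. x \<noteq> y)"
    moreover obtain x where "x \<in> S" using S(2) by (metis countable_empty equals0I)
    ultimately have "S = {x}" by blast
    thus False using S(2) by simp
  qed
  then obtain x y where xy: "x \<in> S" "y \<in> S" "x \<noteq> y" by blast
  have "limsup (\<lambda>n. ereal \<bar>(fmap ^^ n) x - (fmap ^^ n) y\<bar>) \<le> 0"
    by (rule no_li_yorke_pair) (use S xy in auto)
  thus False using S(3)[OF xy] by (simp add: leD)
qed

section \<open>Zero entropy\<close>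

text \<open>This is a partition of the interval into at most \<open>B\<close> classes of diameter at
  most \<open>e\<close> in the \<open>n\<close>-step metric. Codes are lists so that a new code can
  be formed by prepending data to an old one.\<close>

definition code_bound :: "real \<Rightarrow> nat \<Rightarrow> nat \<Rightarrow> bool" where
  "code_bound e n B \<longleftrightarrow> (\<exists>c :: real \<Rightarrow> int list. finite (c ` unitI) \<and> card (c ` unitI) \<le> B \<and>
     (\<forall>x\<in>unitI. \<forall>y\<in>unitI. c x = c y \<longrightarrow> (\<forall>k<n. \<bar>(fmap ^^ k) x - (fmap ^^ k) y\<bar> \<le> e)))"

lemma code_bound_mono:
  assumes "code_bound e n B" "m \<le> n" "B \<le> C" shows "code_bound e m C"
proof -
  obtain c :: "real \<Rightarrow> int list" where "finite (c ` unitI)" "card (c ` unitI) \<le> B"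
    "\<forall>x\<in>unitI. \<forall>y\<in>unitI. c x = c y \<longrightarrow> (\<forall>k<n. \<bar>(fmap ^^ k) x - (fmap ^^ k) y\<bar> \<le> e)"
    using assms(1) unfolding code_bound_def by blast
  thus ?thesis unfolding code_bound_def using assms(2,3)
    by (intro exI[of _ c]) (meson order_trans order_less_le_trans)
qed

lemma floor_eq_close:
  fixes x y e :: real
  assumes "e > 0" "\<lfloor>x / e\<rfloor> = \<lfloor>y / e\<rfloor>" shows "\<bar>x - y\<bar> \<le> e"
proof -
  have "\<bar>x / e - y / e\<bar> \<le> 1" using assms(2) by linarith
  hence "\<bar>(x - y) / e\<bar> \<le> 1" by (simp add: diff_divide_distrib)
  thus ?thesis using assms(1) by (simp add: field_simps)
qed

lemma floor_in_range:
  fixes x e :: real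
  assumes "e > 0" "x \<in> unitI" shows "\<lfloor>x / e\<rfloor> \<in> {0..\<lfloor>1 / e\<rfloor>}"
  using assms by (auto intro!: floor_mono divide_right_mono)

text \<open>The cells of size \<open>e\<close> visited by the iterates give a crude bound, enough
  for the finitely many initial lengths of the recursive estimate.\<close>

lemma code_bound_exists:
  assumes "e > 0" shows "\<exists>B. code_bound e n B"
proof -
  let ?c = "\<lambda>x. map (\<lambda>k. \<lfloor>(fmap ^^ k) x / e\<rfloor>) [0..<n]"
  have "?c ` unitI \<subseteq> {xs. set xs \<subseteq> {0..\<lfloor>1 / e\<rfloor>} \<and> length xs = n}"
    using floor_in_range[OF assms] fmap_funpow_in_unit by fastforce
  moreover have "finite {xs. set xs \<subseteq> {0..\<lfloor>1 / e\<rfloor>} \<and> length xs = n}"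
    by (rule finite_lists_length_eq) simp
  ultimately have "finite (?c ` unitI)" by (rule finite_subset)
  moreover have "\<bar>(fmap ^^ k) x - (fmap ^^ k) y\<bar> \<le> e" if "?c x = ?c y" "k < n" for x y k
    using that by (intro floor_eq_close[OF assms]) auto
  ultimately show ?thesis
    unfolding code_bound_def by (intro exI[of _ "card (?c ` unitI)"] exI[of _ ?c]) auto
qed

lemma funpow_embL:
  assumes "x \<in> {0..1}"
  shows "(fmap ^^ (2 * i)) (embL x) = embL ((fmap ^^ i) x)"
    "(fmap ^^ Suc (2 * i)) (embL x) = embR ((fmap ^^ i) x)"
proof -
  have *: "(fmap ^^ i) x \<in> {0..1}" for i using fmap_funpow_in_unit[OF assms] .
  show 1: "(fmap ^^ (2 * i)) (embL x) = embL ((fmap ^^ i) x)"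
  proof (induction i)
    case (Suc i)
    have "(fmap ^^ (2 * Suc i)) (embL x) = fmap (fmap ((fmap ^^ (2 * i)) (embL x)))" by simp
    thus ?case using Suc *[of i] by (simp add: fmap_embL fmap_embR)
  qed simp
  show "(fmap ^^ Suc (2 * i)) (embL x) = embR ((fmap ^^ i) x)"
    using *[of i] by (simp add: 1 fmap_embL)
qed

text \<open>Two steps in a copy amount to one step of the original. A start in \<open>embR\<close>
  is one step ahead of a start in \<open>embL\<close>, whence \<open>n + 1\<close> instead of
  \<open>n\<close>.\<close>

lemma close_halves:
  assumes u: "u \<in> {0..1}" and v: "v \<in> {0..1}"
    and close: "\<And>k. k < n + 1 \<Longrightarrow> \<bar>(fmap ^^ k) u - (fmap ^^ k) v\<bar> \<le> e"
    and k: "k < 2 * n"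
  shows "\<bar>(fmap ^^ k) (embL u) - (fmap ^^ k) (embL v)\<bar> \<le> e"
    "\<bar>(fmap ^^ k) (embR u) - (fmap ^^ k) (embR v)\<bar> \<le> e"
proof -
  have L: "\<bar>(fmap ^^ j) (embL u) - (fmap ^^ j) (embL v)\<bar> \<le> e" if j: "j < 2 * n + 1" for j
  proof -
    define i where "i = j div 2"
    have i: "j = 2 * i \<or> j = Suc (2 * i)" unfolding i_def by presburger
    hence "\<bar>(fmap ^^ i) u - (fmap ^^ i) v\<bar> \<le> e" using close[of i] j by auto
    thus ?thesis using i funpow_embL[OF u] funpow_embL[OF v]
        order_trans[OF embL_diff_le] order_trans[OF embR_diff_le] by auto
  qed
  show "\<bar>(fmap ^^ k) (embL u) - (fmap ^^ k) (embL v)\<bar> \<le> e" using L k by simp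
  have "(fmap ^^ k) (embR w) = (fmap ^^ Suc k) (embL w)" if "w \<in> {0..1}" for w
    using that by (simp add: fmap_embL funpow_Suc_right del: funpow.simps)
  thus "\<bar>(fmap ^^ k) (embR u) - (fmap ^^ k) (embR v)\<bar> \<le> e"
    using L[of "Suc k"] k u v by simp
qed

text \<open>Differences grow by the factor 7/2 per step in the gap, so the latest one
  dominates.\<close>

lemma gap_close:
  assumes "\<And>i. i < t \<Longrightarrow> (fmap ^^ i) x \<in> {2/5<..<3/5}" "\<And>i. i < t \<Longrightarrow> (fmap ^^ i) y \<in> {2/5<..<3/5}"
    and k: "k \<le> s" "s < t"
  shows "\<bar>(fmap ^^ k) x - (fmap ^^ k) y\<bar> \<le> \<bar>(fmap ^^ s) x - (fmap ^^ s) y\<bar>"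
proof -
  have *: "\<bar>(fmap ^^ i) x - (fmap ^^ i) y\<bar> = (7/2) ^ i * \<bar>x - y\<bar>" if "i < t" for i
  proof -
    have "(fmap ^^ i) x - (fmap ^^ i) y = (-7/2) ^ i * (x - y)"
      using gap_funpow[of i x] gap_funpow[of i y] assms(1,2) that by (simp add: algebra_simps)
    thus ?thesis by (simp add: abs_mult power_abs)
  qed
  show ?thesis using k *[of k] *[of s] by (auto intro!: mult_right_mono power_increasing)
qed

text \<open>The code of a point records its exit time from the middle gap, its approximate position just
  before leaving (the map expands there, so this controls the whole stay), and the code of the point
  of which the exit position is a copy under \<open>embL\<close> or \<open>embR\<close>; time runs twice as slow in the copies.\<close>

lemma code_bound_double:
  assumes e: "e > 0" and B: "code_bound e (n + 1) B"
  shows "code_bound e (2 * n) ((2 * n + 1) * (nat \<lfloor>1 / e\<rfloor> + 1) * (2 * B + 1))"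
proof -
  obtain c :: "real \<Rightarrow> int list" where c: "finite (c ` unitI)" "card (c ` unitI) \<le> B"
    "\<And>x y k. x \<in> unitI \<Longrightarrow> y \<in> unitI \<Longrightarrow> c x = c y \<Longrightarrow> k < n + 1 \<Longrightarrow> \<bar>(fmap ^^ k) x - (fmap ^^ k) y\<bar> \<le> e"
    using B unfolding code_bound_def by blast
  define gap where "gap = {2/5<..<3/5::real}"
  \<comment> \<open>The labels 0 and 1 record the side. The empty list is the value inside the gap;
    it arises at the exit position only if the cap \<open>2 * n\<close> is reached, when no later
    time remains to be compared.\<close>
  define r where "r z = (if z \<in> embL ` unitI then 0 # c (inv_into unitI embL z)
    else if z \<in> embR ` unitI then 1 # c (inv_into unitI embR z) else [])" for z
  \<comment> \<open>The cap \<open>2 * n\<close> makes the least time exist and leaves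
    \<open>2 * n + 1\<close> possible values.\<close>
  define T where "T x = (LEAST t. t \<ge> 2 * n \<or> (fmap ^^ t) x \<notin> gap)" for x
  \<comment> \<open>\<open>T x - 1\<close> is the last recorded time in the gap; 0 is a placeholder
    when there is none.\<close>
  define p where "p x = (if T x = 0 then 0 else \<lfloor>(fmap ^^ (T x - 1)) x / e\<rfloor>)" for x
  define c' where "c' x = int (T x) # p x # r ((fmap ^^ T x) x)" for x
  have T: "T x \<le> 2 * n" "\<And>i. i < T x \<Longrightarrow> (fmap ^^ i) x \<in> gap"
    "T x < 2 * n \<Longrightarrow> (fmap ^^ T x) x \<notin> gap" for x
  proof -
    have ex: "2 * n \<ge> 2 * n \<or> (fmap ^^ (2 * n)) x \<notin> gap" by simp
    show "T x \<le> 2 * n" unfolding T_def by (rule Least_le) simp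
    show "(fmap ^^ i) x \<in> gap" if "i < T x" for i
      using not_less_Least[OF that[unfolded T_def]] by blast
    show "(fmap ^^ T x) x \<notin> gap" if "T x < 2 * n"
      using LeastI[of "\<lambda>t. t \<ge> 2 * n \<or> (fmap ^^ t) x \<notin> gap", OF ex] that
        unfolding T_def by linarith
  qed
  let ?R = "(#) 0 ` c ` unitI \<union> (#) 1 ` c ` unitI \<union> {[]}"
  have r_in: "r z \<in> ?R" for z
  proof -
    have "inv_into unitI embL z \<in> unitI" if "z \<in> embL ` unitI"
      using that by (rule inv_into_into)
    moreover have "inv_into unitI embR z \<in> unitI" if "z \<in> embR ` unitI"
      using that by (rule inv_into_into)
    ultimately show ?thesis unfolding r_def by auto
  qed
  have fin_R: "finite ?R" using c(1) by simp
  have card_R: "card ?R \<le> 2 * B + 1"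
  proof -
    have "card ?R \<le> card ((#) 0 ` c ` unitI) + card ((#) 1 ` c ` unitI) + card {[] :: int list}"
      by (intro order_trans[OF card_Un_le] add_mono card_Un_le) simp
    moreover have "card ((#) a ` c ` unitI) \<le> B" for a
      using card_image_le[OF c(1), of "(#) a"] c(2) by linarith
    hence "card ((#) 0 ` c ` unitI) + card ((#) 1 ` c ` unitI) + card {[] :: int list} \<le> B + B + 1"
      by (intro add_mono) auto
    ultimately show ?thesis by linarith
  qed
  let ?S = "{..2 * n} \<times> {0..\<lfloor>1 / e\<rfloor>} \<times> ?R"
  let ?h = "\<lambda>(t, q, l). int t # q # l"
  have sub: "c' ` unitI \<subseteq> ?h ` ?S"
  proof
    fix z assume "z \<in> c' ` unitI"
    then obtain x where x: "x \<in> unitI" "z = c' x" by blast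
    have "p x \<in> {0..\<lfloor>1 / e\<rfloor>}"
      unfolding p_def using floor_in_range[OF e fmap_funpow_in_unit[OF x(1)]] e by auto
    hence "(T x, p x, r ((fmap ^^ T x) x)) \<in> ?S" using T(1) r_in by blast
    thus "z \<in> ?h ` ?S" unfolding x(2) c'_def by (rule rev_image_eqI) simp
  qed
  have fin_S: "finite ?S" using fin_R by simp
  have fin: "finite (c' ` unitI)" by (rule finite_subset[OF sub]) (use fin_S in simp)
  have "card (c' ` unitI) \<le> card (?h ` ?S)" using sub fin_S by (intro card_mono) auto
  also have "\<dots> \<le> card ?S" using fin_S by (rule card_image_le)
  also have "\<dots> = (2 * n + 1) * (nat (\<lfloor>1 / e\<rfloor> + 1) * card ?R)"
    by (simp only: card_cartesian_product card_atMost card_atLeastAtMost_int) simp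
  also have "\<dots> \<le> (2 * n + 1) * ((nat \<lfloor>1 / e\<rfloor> + 1) * (2 * B + 1))"
    using card_R e by (intro mult_mono) (auto simp: nat_add_distrib)
  finally have card: "card (c' ` unitI) \<le> (2 * n + 1) * (nat \<lfloor>1 / e\<rfloor> + 1) * (2 * B + 1)"
    by (simp only: mult.assoc)
  have close: "\<bar>(fmap ^^ k) x - (fmap ^^ k) y\<bar> \<le> e"
    if x: "x \<in> unitI" and y: "y \<in> unitI" and eq: "c' x = c' y" and k: "k < 2 * n" for x y k
  proof -
    have eqs: "T y = T x" "p x = p y" "r ((fmap ^^ T x) x) = r ((fmap ^^ T x) y)"
      using eq unfolding c'_def by auto
    show ?thesis
    proof (cases "k < T x")
      case True
      have "\<bar>(fmap ^^ k) x - (fmap ^^ k) y\<bar> \<le> \<bar>(fmap ^^ (T x - 1)) x - (fmap ^^ (T x - 1)) y\<bar>"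
        using T(2)[of _ x] T(2)[of _ y] eqs(1) True unfolding gap_def
        by (intro gap_close[of "T x"]) auto
      also have "\<dots> \<le> e"
        using eqs True unfolding p_def by (intro floor_eq_close[OF e]) auto
      finally show ?thesis .
    next
      case False
      let ?u = "(fmap ^^ T x) x" and ?v = "(fmap ^^ T x) y"
      have T': "T x < 2 * n" using False k by simp
      have uv: "?u \<in> unitI" "?v \<in> unitI" using x y fmap_funpow_in_unit by blast+
      have "?u \<notin> gap" "?v \<notin> gap" using T(3)[OF T'] T(3)[of y] T' eqs(1) by auto
      hence sides: "?u \<in> embL ` unitI \<or> ?u \<in> embR ` unitI" "?v \<in> embL ` unitI \<or> ?v \<in> embR ` unitI"
        using not_in_gap uv unfolding gap_def by blast+
      have invL: "inv_into unitI embL z \<in> unitI" "embL (inv_into unitI embL z) = z" if "z \<in> embL ` unitI" for z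
        using that by (rule inv_into_into, rule f_inv_into_f)
      have invR: "inv_into unitI embR z \<in> unitI" "embR (inv_into unitI embR z) = z" if "z \<in> embR ` unitI" for z
        using that by (rule inv_into_into, rule f_inv_into_f)
      have kT: "k - T x < 2 * n" using k by simp
      have "\<bar>(fmap ^^ (k - T x)) ?u - (fmap ^^ (k - T x)) ?v\<bar> \<le> e"
      proof (cases "?u \<in> embL ` unitI")
        case True
        hence v: "?v \<in> embL ` unitI"
          using eqs(3) sides unfolding r_def by (auto split: if_splits)
        let ?a = "inv_into unitI embL ?u" and ?b = "inv_into unitI embL ?v"
        have "c ?a = c ?b" using eqs(3) True v unfolding r_def by simp
        hence "\<And>k. k < n + 1 \<Longrightarrow> \<bar>(fmap ^^ k) ?a - (fmap ^^ k) ?b\<bar> \<le> e"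
          using c(3) invL(1)[OF True] invL(1)[OF v] by blast
        from close_halves(1)[OF invL(1)[OF True] invL(1)[OF v] this kT]
        show ?thesis unfolding invL(2)[OF True] invL(2)[OF v] .
      next
        case False
        hence u: "?u \<in> embR ` unitI" using sides by blast
        have vL: "?v \<notin> embL ` unitI"
          using eqs(3) False u unfolding r_def by (auto split: if_splits)
        hence v: "?v \<in> embR ` unitI" using sides by blast
        let ?a = "inv_into unitI embR ?u" and ?b = "inv_into unitI embR ?v"
        have "c ?a = c ?b" using eqs(3) False u v vL unfolding r_def by simp
        hence "\<And>k. k < n + 1 \<Longrightarrow> \<bar>(fmap ^^ k) ?a - (fmap ^^ k) ?b\<bar> \<le> e"
          using c(3) invR(1)[OF u] invR(1)[OF v] by blast
        from close_halves(2)[OF invR(1)[OF u] invR(1)[OF v] this kT]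
        show ?thesis unfolding invR(2)[OF u] invR(2)[OF v] .
      qed
      moreover have "(fmap ^^ (k - T x)) ((fmap ^^ T x) z) = (fmap ^^ k) z" for z
        using False funpow_split[of "T x" k fmap z] by simp
      ultimately show ?thesis by simp
    qed
  qed
  show ?thesis unfolding code_bound_def using fin card close by blast
qed

text \<open>Halving the length costs a factor linear in \<open>n\<close>, which half of the
  exponential eventually absorbs. \<open>K\<close> takes care of the lengths below the
  threshold.\<close>

lemma code_bound_subexponential:
  assumes e: "e > 0" and d: "d > 0"
  obtains K where "K \<ge> 1" "\<And>n. \<exists>B. code_bound e n B \<and> real B \<le> K * exp (d * real n)"
proof -
  define M where "M = real (nat \<lfloor>1 / e\<rfloor> + 1)"
  \<comment> \<open>With 2 m at most n + 1, the factor \<open>2 * m + 1\<close> is at most n + 2 and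
    the exponent for length m + 1 is at most the one shown; the 3 comes from 2 E + 1 being at most 3
    E for E at least 1.\<close>
  have "\<forall>\<^sub>F n::nat in sequentially. 3 * M * (real n + 2) * exp (d * (real n / 2 + 3 / 2)) \<le> exp (d * real n)"
    using d by real_asymp
  then obtain N0 where N0: "\<And>n. n \<ge> N0 \<Longrightarrow> 3 * M * (real n + 2) * exp (d * (real n / 2 + 3 / 2)) \<le> exp (d * real n)"
    unfolding eventually_sequentially by blast
  \<comment> \<open>From 4 on, \<open>m + 1 < n\<close> holds, so the induction hypothesis
    applies.\<close>
  define N where "N = max N0 4"
  obtain b where b: "\<And>n. code_bound e n (b n)" using code_bound_exists[OF e] by metis
  define K where "K = real (Max (insert 1 (b ` {..<N})))"
  have K1: "K \<ge> 1"
  proof -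
    have "1 \<le> Max (insert 1 (b ` {..<N}))" by (intro Max_ge) auto
    thus ?thesis unfolding K_def by simp
  qed
  have "\<exists>B. code_bound e n B \<and> real B \<le> K * exp (d * real n)" for n
  proof (induction n rule: less_induct)
    case (less n)
    show ?case
    proof (cases "n < N")
      case True
      have "b n \<le> Max (insert 1 (b ` {..<N}))" using True by (intro Max_ge) auto
      hence "real (b n) \<le> K * 1" unfolding K_def by simp
      also have "\<dots> \<le> K * exp (d * real n)" using K1 d by (intro mult_left_mono) auto
      finally show ?thesis using b by blast
    next
      case False
      define m where "m = (n + 1) div 2"
      have m: "n \<le> 2 * m" "2 * m \<le> n + 1" "m + 1 < n"
        using False by (auto simp: m_def N_def)
      obtain B where B: "code_bound e (m + 1) B" "real B \<le> K * exp (d * real (m + 1))"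
        using less[OF m(3)] by blast
      let ?C = "(2 * m + 1) * (nat \<lfloor>1 / e\<rfloor> + 1) * (2 * B + 1)"
      have "code_bound e n ?C" using code_bound_mono[OF code_bound_double[OF e B(1)] m(1)] by blast
      moreover have "real ?C \<le> K * exp (d * real n)"
      proof -
        let ?E = "K * exp (d * (real n / 2 + 3 / 2))"
        have "real (m + 1) \<le> real n / 2 + 3 / 2" using m(2) by linarith
        hence "K * exp (d * real (m + 1)) \<le> ?E" using K1 d by (intro mult_left_mono) auto
        hence BE: "real B \<le> ?E" using B(2) by linarith
        have E1: "1 \<le> ?E"
        proof -
          have "1 * 1 \<le> ?E" using K1 d by (intro mult_mono) auto
          thus ?thesis by simp
        qed
        have "real ?C = (2 * real m + 1) * M * (2 * real B + 1)"
          unfolding M_def by (simp only: of_nat_mult of_nat_add of_nat_1 of_nat_numeral)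
        also have "\<dots> \<le> (real n + 2) * M * (3 * ?E)"
        proof (intro mult_mono)
          show "2 * real m + 1 \<le> real n + 2" using m(2) by linarith
          show "2 * real B + 1 \<le> 3 * ?E" using BE E1 by linarith
        qed (auto simp: M_def)
        also have "\<dots> = K * (3 * M * (real n + 2) * exp (d * (real n / 2 + 3 / 2)))" by simp
        also have "\<dots> \<le> K * exp (d * real n)"
          using N0[of n] False K1 by (intro mult_left_mono) (auto simp: N_def)
        finally show ?thesis .
      qed
      ultimately show ?thesis by blast
    qed
  qed
  thus thesis using that K1 by blast
qed

section \<open>From codes to separated sets and entropy\<close>

lemma sep_num_le_code_bound:
  assumes "code_bound e n B" shows "sep_num fmap unitI n e \<le> B"
proof -
  obtain c :: "real \<Rightarrow> int list" where c: "finite (c ` unitI)" "card (c ` unitI) \<le> B"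
    "\<And>x y k. x \<in> unitI \<Longrightarrow> y \<in> unitI \<Longrightarrow> c x = c y \<Longrightarrow> k < n \<Longrightarrow> \<bar>(fmap ^^ k) x - (fmap ^^ k) y\<bar> \<le> e"
    using assms unfolding code_bound_def by blast
  have "card E \<le> B" if E: "E \<subseteq> unitI" "separated fmap n e E" for E
  proof -
    \<comment> \<open>Equal codes would keep two points within \<open>e\<close> up to time
      \<open>n\<close>, contrary to separation.\<close>
    have "inj_on c E"
    proof (rule inj_onI, rule ccontr)
      fix x y assume "x \<in> E" "y \<in> E" "c x = c y" "x \<noteq> y"
      moreover from this obtain k where "k < n" "\<bar>(fmap ^^ k) x - (fmap ^^ k) y\<bar> > e"
        using E(2) unfolding separated_def by blast
      ultimately show False using c(3)[of x y k] E(1) by (auto simp: subset_iff not_le[symmetric])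
    qed
    hence "card E \<le> card (c ` unitI)" using E(1) c(1) by (intro card_inj_on_le[of c]) auto
    thus ?thesis using c(2) by simp
  qed
  \<comment> \<open>The empty set witnesses that the supremum is over a nonempty set of
    cardinalities.\<close>
  moreover have "finite {} \<and> {} \<subseteq> unitI \<and> separated fmap n e {}"
    by (simp add: separated_def)
  ultimately show ?thesis unfolding sep_num_def by (intro cSup_least) blast+
qed

lemma ln_of_nat_nonneg: "0 \<le> ln (real k)"
  by (cases "k = 0") auto

text \<open>Growth at rate at most \<open>d / 2\<close> holds for each positive \<open>d\<close>,
  and the constant \<open>K\<close> vanishes after division by \<open>n\<close>.\<close>

lemma top_entropy_fmap: "top_entropy fmap unitI = 0"
proof -
  let ?a = "\<lambda>e n. ln (real (sep_num fmap unitI n e)) / real n"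
  have "limsup (\<lambda>n. ereal (?a e n)) \<le> 0" if e: "e > 0" for e
  proof (rule ereal_le_epsilon2)
    fix d :: real assume d: "d > 0"
    hence d2: "d / 2 > 0" by simp
    obtain K where K: "K \<ge> 1" "\<And>n. \<exists>B. code_bound e n B \<and> real B \<le> K * exp (d / 2 * real n)"
      using code_bound_subexponential[OF e d2] by metis
    have bd: "?a e n \<le> ln K / real n + d / 2" if n: "n > 0" for n
    proof (cases "sep_num fmap unitI n e = 0")
      \<comment> \<open>At 0 the logarithm has its default value 0, and \<open>ln K\<close> is
        nonnegative.\<close>
      case True
      thus ?thesis using K(1) d n by simp
    next
      case False
      obtain B where B: "code_bound e n B" "real B \<le> K * exp (d / 2 * real n)"
        using K(2) by blast
      have "real (sep_num fmap unitI n e) \<le> K * exp (d / 2 * real n)"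
        using sep_num_le_code_bound[OF B(1)] B(2) by linarith
      hence "ln (real (sep_num fmap unitI n e)) \<le> ln (K * exp (d / 2 * real n))"
        using False K(1) by (subst ln_le_cancel_iff) auto
      also have "\<dots> = ln K + d / 2 * real n" using K(1) by (simp add: ln_mult)
      finally show ?thesis using n by (simp add: field_simps)
    qed
    have "(\<lambda>n. ln K / real n + d / 2) \<longlonglongrightarrow> d / 2" by real_asymp
    hence "\<forall>\<^sub>F n in sequentially. ln K / real n + d / 2 < d"
      by (rule order_tendstoD(2)) (use d in simp)
    moreover have "\<forall>\<^sub>F n in sequentially. (0::nat) < n" by (rule eventually_gt_at_top)
    ultimately have "\<forall>\<^sub>F n in sequentially. ereal (?a e n) \<le> ereal d"
    proof eventually_elim
      case (elim n)
      thus ?case using bd[of n] by simp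
    qed
    hence "limsup (\<lambda>n. ereal (?a e n)) \<le> ereal d" by (rule Limsup_bounded)
    thus "limsup (\<lambda>n. ereal (?a e n)) \<le> 0 + ereal d" by simp
  qed
  moreover have "0 \<le> limsup (\<lambda>n. ereal (?a e n))" for e
    by (rule le_Limsup) (auto intro!: always_eventually divide_nonneg_nonneg ln_of_nat_nonneg)
  ultimately have "limsup (\<lambda>n. ereal (?a e n)) = 0" if "e > 0" for e
    using that by (intro antisym) auto
  hence "top_entropy fmap unitI = (SUP e\<in>{0::real<..}. 0)"
    unfolding top_entropy_def by (intro SUP_cong) auto
  also have "\<dots> = 0" by (rule SUP_const) simp
  finally show ?thesis .
qed

section \<open>Assembly of the claims\<close>

theorem mainTheorem3:
  shows "\<exists>f :: real \<Rightarrow> real.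
     continuous_on unitI f \<and> f ` unitI = unitI \<and>
     top_entropy f unitI = 0 \<and>
     \<not> li_yorke_chaotic f \<and>
     (\<exists>W. infinite W \<and> (\<exists>x\<in>unitI. W = omega_limit f x) \<and>
          (\<forall>x\<in>unitI. infinite (omega_limit f x) \<longrightarrow> omega_limit f x = W) \<and>
          (\<exists>J. assoc_system f W J) \<and>
          (\<forall>J. assoc_system f W J \<longrightarrow>
              interior (simple_set J) \<noteq> {} \<and>
              (\<exists>G :: int \<Rightarrow> real set. bij_betw G UNIV (nondeg_components (simple_set J)) \<and>
                  (\<forall>n. f ` (G n) = G (n + 1)))))"
proof (intro exI[of _ fmap] conjI)
  show "continuous_on unitI fmap" by (rule continuous_fmap)
  show "fmap ` unitI = unitI" by (rule fmap_image)
  show "top_entropy fmap unitI = 0" by (rule top_entropy_fmap)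
  show "\<not> li_yorke_chaotic fmap" by (rule not_li_yorke_chaotic)
  show "\<exists>W. infinite W \<and> (\<exists>x\<in>unitI. W = omega_limit fmap x) \<and>
          (\<forall>x\<in>unitI. infinite (omega_limit fmap x) \<longrightarrow> omega_limit fmap x = W) \<and>
          (\<exists>J. assoc_system fmap W J) \<and>
          (\<forall>J. assoc_system fmap W J \<longrightarrow>
              interior (simple_set J) \<noteq> {} \<and>
              (\<exists>G :: int \<Rightarrow> real set. bij_betw G UNIV (nondeg_components (simple_set J)) \<and>
                  (\<forall>n. fmap ` (G n) = G (n + 1))))"
  proof (intro exI[of _ cantor] conjI ballI allI impI)
    show "infinite cantor" by (rule infinite_cantor)
    show "\<exists>x\<in>unitI. cantor = omega_limit fmap x"
      using omega_limit_deep[OF deep_fifth] by (intro bexI[of _ "1/5"]) auto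
    show "omega_limit fmap x = cantor" if "x \<in> unitI" "infinite (omega_limit fmap x)" for x
      using that omega_limit_deep omega_limit_not_deep by blast
    show "\<exists>J. assoc_system fmap cantor J" using assoc_system_blocks by blast
    fix J assume J: "assoc_system fmap cantor J"
    show "interior (simple_set J) \<noteq> {}"
      unfolding simple_set_eq[OF J] by (rule interior_blocks)
    have "bij_betw wander UNIV (nondeg_components (simple_set J))"
      unfolding simple_set_eq[OF J] nondeg_components_eq
        using inj_wander by (simp add: bij_betw_def)
    thus "\<exists>G :: int \<Rightarrow> real set. bij_betw G UNIV (nondeg_components (simple_set J)) \<and>
        (\<forall>n. fmap ` (G n) = G (n + 1))"
      using fmap_wander by blast
  qed
qed

end
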